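(* Let $k,c$ be real numbers with $c>\frac12$ and $k-4c>4$, and for each integer $L\ge3$ set $J=J(L)=k\log L$ and $q=q(L)=c\,\frac{\log L}{L}$. Let $P$ be the transition matrix of the probabilistic cellular automaton on $\{-1,1\}^{\Lambda}$, $\Lambda=(\mathbb Z/L\mathbb Z)^2$, with parameters $J,q$, let $\pi_{PCA}$ be its stationary distribution (both defined in the context), and let $$d_{PCA}(t)=\sup_{\sigma\in\{-1,1\}^\Lambda}\Vert P^t(\sigma,\cdot)-\pi_{PCA}(\cdot)\Vert_{TV},\qquad t\in\mathbb N .$$ Then $$\lim_{L\to\infty}d_{PCA}\left(\lfloor L^{8k}\rfloor\right)=0 .$$
   Context: Let $\Lambda=(\mathbb Z/L\mathbb Z)^2$ and $\mathcal S=\{-1,1\}^{\Lambda}$. For $x=(i,j)\in\Lambda$ put $x^u=(i,j+1)$, $x^r=(i+1,j)$, $x^d=(i,j-1)$, $x^l=(i-1,j)$ (sums mod $L$), and for $\sigma\in\mathcal S$ write $\sigma_x^u=\sigma_{x^u}$, and similarly $\sigma_x^r,\sigma_x^d,\sigma_x^l$. For $\sigma,\tau\in\mathcal S$ let $$H(\sigma,\tau)=-\sum_{x\in\Lambda}\left[J\sigma_x(\tau_x^u+\tau_x^r)+q\sigma_x\tau_x\right]=-\sum_{x\in\Lambda}\left[J\tau_x(\sigma_x^d+\sigma_x^l)+q\sigma_x\tau_x\right],\qquad Z_\sigma=\sum_{\tau\in\mathcal S}e^{-H(\sigma,\tau)}.$$ The PCA is the discrete-time Markov chain on $\mathcal S$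 with transition matrix $P(\sigma,\tau)=e^{-H(\sigma,\tau)}/Z_\sigma$. Its unique stationary distribution is $\pi_{PCA}(\sigma)=Z_\sigma/\sum_{\sigma'\in\mathcal S}Z_{\sigma'}$. $\Vert\cdot\Vert_{TV}$ denotes total variation distance. *)

theory Defs
  imports Complex_Main "HOL-Library.FuncSet"
begin

text \<open>\<open>\<int>/L\<int>\<close> is represented by the residues \<open>{0..<L}\<close>, and spin configurations are
  the functions on the torus with values in \<open>{-1, 1}\<close>. They are taken
  extensional (fixed outside the torus), so that there are exactly \<open>2 ^ L\<^sup>2\<close> of them.\<close>

type_synonym site = "int \<times> int"
type_synonym config = "site \<Rightarrow> real"

definition torus :: "nat \<Rightarrow> site set" where
  "torus L = {0..<int L} \<times> {0..<int L}"

definition configs :: "nat \<Rightarrow> config set" where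
  "configs L = torus L \<rightarrow>\<^sub>E {-1, 1}"

definition up :: "nat \<Rightarrow> site \<Rightarrow> site" where
  "up L x = (fst x, (snd x + 1) mod int L)"

definition right :: "nat \<Rightarrow> site \<Rightarrow> site" where
  "right L x = ((fst x + 1) mod int L, snd x)"

definition down :: "nat \<Rightarrow> site \<Rightarrow> site" where
  "down L x = (fst x, (snd x - 1) mod int L)"

definition left :: "nat \<Rightarrow> site \<Rightarrow> site" where
  "left L x = ((fst x - 1) mod int L, snd x)"

definition H :: "nat \<Rightarrow> real \<Rightarrow> real \<Rightarrow> config \<Rightarrow> config \<Rightarrow> real" where
  "H L J q \<sigma> \<tau> =
     - (\<Sum>x\<in>torus L. J * \<sigma> x * (\<tau> (up L x) + \<tau> (right L x)) + q * \<sigma> x * \<tau> x)"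

definition Z :: "nat \<Rightarrow> real \<Rightarrow> real \<Rightarrow> config \<Rightarrow> real" where
  "Z L J q \<sigma> = (\<Sum>\<tau>\<in>configs L. exp (- H L J q \<sigma> \<tau>))"

definition P :: "nat \<Rightarrow> real \<Rightarrow> real \<Rightarrow> config \<Rightarrow> config \<Rightarrow> real" where
  "P L J q \<sigma> \<tau> = exp (- H L J q \<sigma> \<tau>) / Z L J q \<sigma>"

definition pi_PCA :: "nat \<Rightarrow> real \<Rightarrow> real \<Rightarrow> config \<Rightarrow> real" where
  "pi_PCA L J q \<sigma> = Z L J q \<sigma> / (\<Sum>\<sigma>'\<in>configs L. Z L J q \<sigma>')"

text \<open>Powers of a matrix whose rows and columns are indexed by a finite set \<open>S\<close>.\<close>

fun mat_pow :: "'s set \<Rightarrow> ('s \<Rightarrow> 's \<Rightarrow> real) \<Rightarrow> nat \<Rightarrow> 's \<Rightarrow> 's \<Rightarrow> real" where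
  "mat_pow S M 0 \<sigma> \<tau> = (if \<sigma> = \<tau> then 1 else 0)"
| "mat_pow S M (Suc t) \<sigma> \<tau> = (\<Sum>\<rho>\<in>S. mat_pow S M t \<sigma> \<rho> * M \<rho> \<tau>)"

text \<open>Total variation distance of two probability mass functions on a finite set \<open>S\<close>:
  the largest difference of the probabilities of an event.\<close>

definition tv_dist :: "'s set \<Rightarrow> ('s \<Rightarrow> real) \<Rightarrow> ('s \<Rightarrow> real) \<Rightarrow> real" where
  "tv_dist S \<mu> \<nu> = (SUP A\<in>Pow S. \<bar>sum \<mu> A - sum \<nu> A\<bar>)"

definition d_PCA :: "nat \<Rightarrow> real \<Rightarrow> real \<Rightarrow> nat \<Rightarrow> real" where
  "d_PCA L J q t =
     (SUP \<sigma>\<in>configs L. tv_dist (configs L) (mat_pow (configs L) (P L J q) t \<sigma>) (pi_PCA L J q))"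

lemma sum_torus_shift:
  fixes f :: "site \<Rightarrow> real"
  shows "(\<Sum>x\<in>torus L. f (up L x)) = (\<Sum>x\<in>torus L. f x)"
    and "(\<Sum>x\<in>torus L. f (right L x)) = (\<Sum>x\<in>torus L. f x)"
    and "x \<in> torus L \<Longrightarrow> down L (up L x) = x"
    and "x \<in> torus L \<Longrightarrow> left L (right L x) = x"
proof -
  show "(\<Sum>x\<in>torus L. f (up L x)) = (\<Sum>x\<in>torus L. f x)"
    by (rule sum.reindex_bij_witness[of _ "down L" "up L"])
       (auto simp: torus_def up_def down_def mod_simps)
  show "(\<Sum>x\<in>torus L. f (right L x)) = (\<Sum>x\<in>torus L. f x)"
    by (rule sum.reindex_bij_witness[of _ "left L" "right L"])
       (auto simp: torus_def right_def left_def mod_simps)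
qed (auto simp: torus_def up_def down_def right_def left_def mod_simps)

lemma H_alt:
  "H L J q \<sigma> \<tau> =
     - (\<Sum>x\<in>torus L. J * \<tau> x * (\<sigma> (down L x) + \<sigma> (left L x)) + q * \<sigma> x * \<tau> x)"
proof -
  have u: "(\<Sum>x\<in>torus L. J * \<sigma> x * \<tau> (up L x)) = (\<Sum>x\<in>torus L. J * \<tau> x * \<sigma> (down L x))"
    unfolding sum_torus_shift(1)[of "\<lambda>x. J * \<tau> x * \<sigma> (down L x)", symmetric]
    by (rule sum.cong) (auto simp: sum_torus_shift(3))
  have r: "(\<Sum>x\<in>torus L. J * \<sigma> x * \<tau> (right L x)) = (\<Sum>x\<in>torus L. J * \<tau> x * \<sigma> (left L x))"
    unfolding sum_torus_shift(2)[of "\<lambda>x. J * \<tau> x * \<sigma> (left L x)", symmetric]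
    by (rule sum.cong) (auto simp: sum_torus_shift(4))
  show ?thesis
    using u r by (simp add: H_def distrib_left sum.distrib)
qed

end

theory Submission
  imports Defs "HOL-Analysis.Convex" "HOL-Real_Asymp.Real_Asymp"
begin

text \<open>The proof bounds the spectral gap by canonical paths. The chain is not reversible, but the loss of
  \<open>L\<^sup>2\<close>-norm in one step, \<open>E f\<^sup>2 - E (P f)\<^sup>2\<close>, is the mean variance of \<open>f\<close> under the product measures
  \<open>P \<sigma>\<close>, and this dominates a Dirichlet form of single spin flips. From \<open>\<sigma>\<close> to \<open>\<sigma>'\<close> one goes by
  updating the sites one after the other along the antidiagonals, since the strong coupling \<open>J\<close> in
  \<open>Z\<close> acts only within antidiagonals: at any time it is cut at no more than two places, and the weak
  coupling \<open>q\<close> at no more than \<open>2 L\<close> sites.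
  An intermediate configuration \<open>\<eta>\<close> determines \<open>(\<sigma>, \<sigma>')\<close> together with the complementary mixture
  \<open>\<zeta>\<close>, or with \<open>\<zeta>\<close> negated on the updated part; averaging over these two encodings costs a factor
  \<open>exp (6 J)\<close> instead of \<open>exp (8 J)\<close>. Moreover each flip of a path is performed next to a sign change
  of its antidiagonal, before or after the flip, and such a flip has a rate of order one. The
  relaxation time is thus at most of order \<open>L\<^sup>4 exp (6 J + 8 q L) = L powr (6 k + 8 c + 4)\<close>, and the
  warm-up factor \<open>ln (1 / min \<pi>)\<close> is of order \<open>L\<^sup>2 ln L\<close>, while \<open>8 k > 6 k + 8 c + 8\<close>.\<close>

section \<open>Variance decay of a finite Markov chain\<close>

lemma weighted_square_le:
  fixes v g :: "'a \<Rightarrow> real"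
  assumes "\<And>x. x \<in> S \<Longrightarrow> 0 \<le> v x"
  shows "(\<Sum>x\<in>S. v x * g x)\<^sup>2 \<le> (\<Sum>x\<in>S. v x) * (\<Sum>x\<in>S. v x * (g x)\<^sup>2)"
proof -
  have "(\<Sum>x\<in>S. v x * g x)\<^sup>2 = (\<Sum>x\<in>S. sqrt (v x) * (sqrt (v x) * g x))\<^sup>2"
    using assms by (intro arg_cong[where f = "\<lambda>s. s\<^sup>2"] sum.cong) (auto simp flip: mult.assoc)
  also have "\<dots> \<le> (\<Sum>x\<in>S. (sqrt (v x))\<^sup>2) * (\<Sum>x\<in>S. (sqrt (v x) * g x)\<^sup>2)"
    by (rule Cauchy_Schwarz_ineq_sum)
  also have "\<dots> = (\<Sum>x\<in>S. v x) * (\<Sum>x\<in>S. v x * (g x)\<^sup>2)"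
    using assms by (intro arg_cong2[where f = "(*)"] sum.cong) (auto simp: power_mult_distrib)
  finally show ?thesis .
qed

lemma sum_involution:
  assumes "\<And>x. x \<in> S \<Longrightarrow> i x \<in> S" and "\<And>x. x \<in> S \<Longrightarrow> i (i x) = x"
  shows "(\<Sum>x\<in>S. f (i x)) = (\<Sum>x\<in>S. f x)"
  using assms by (intro sum.reindex_bij_witness[of _ i i]) auto

text \<open>Law of total variance: conditioning on the orbits \<open>{x, i x}\<close> leaves the mean conditional
  variance as a lower bound.\<close>

lemma variance_ge_orbit_variance:
  fixes w f :: "'a \<Rightarrow> real"
  assumes "\<And>x. x \<in> S \<Longrightarrow> 0 < w x" and "sum w S = 1"
    and "\<And>x. x \<in> S \<Longrightarrow> i x \<in> S" and "\<And>x. x \<in> S \<Longrightarrow> i (i x) = x"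
  shows "(\<Sum>x\<in>S. w x * w (i x) / (w x + w (i x)) * (f x - f (i x))\<^sup>2) / 2
    \<le> (\<Sum>x\<in>S. w x * (f x)\<^sup>2) - (\<Sum>x\<in>S. w x * f x)\<^sup>2"
proof -
  note inv = sum_involution[OF assms(3,4)]
  \<comment> \<open>\<open>v\<close> averages the weights over an orbit and \<open>g\<close> is the
    conditional mean of \<open>f\<close> on it; both are constant on orbits.\<close>
  define v where "v x = (w x + w (i x)) / 2" for x
  define g where "g x = (w x * f x + w (i x) * f (i x)) / (w x + w (i x))" for x
  have v_pos: "0 < v x" if "x \<in> S" for x
    using assms(1)[OF that] assms(1)[OF assms(3)[OF that]] by (simp add: v_def)
  have v_sum: "sum v S = 1"
    using assms(2) inv[of w] by (simp add: v_def sum.distrib flip: sum_divide_distrib)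
  have vg: "v x * g x = (w x * f x + w (i x) * f (i x)) / 2" if "x \<in> S" for x
  proof -
    define W where "W = w x + w (i x)"
    have "W \<noteq> 0" using v_pos[OF that] by (simp add: W_def v_def)
    then show ?thesis by (simp add: v_def g_def flip: W_def)
  qed
  have 1: "(\<Sum>x\<in>S. w x * f x) = (\<Sum>x\<in>S. v x * g x)"
    using inv[of "\<lambda>x. w x * f x"]
    by (simp add: vg sum.distrib flip: sum_divide_distrib)
  have *: "(w x * (f x)\<^sup>2 + w (i x) * (f (i x))\<^sup>2) / 2
      = v x * (g x)\<^sup>2 + w x * w (i x) / (w x + w (i x)) * (f x - f (i x))\<^sup>2 / 2"
    if "x \<in> S" for x
  proof -
    define W where "W = w x + w (i x)"
    have W: "W \<noteq> 0" using v_pos[OF that] by (simp add: W_def v_def)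
    have "(w x * (f x)\<^sup>2 + w (i x) * (f (i x))\<^sup>2) * W
      = (w x * f x + w (i x) * f (i x))\<^sup>2 + w x * w (i x) * (f x - f (i x))\<^sup>2"
      by (simp add: W_def power2_eq_square algebra_simps)
    then have "w x * (f x)\<^sup>2 + w (i x) * (f (i x))\<^sup>2
      = ((w x * f x + w (i x) * f (i x))\<^sup>2 + w x * w (i x) * (f x - f (i x))\<^sup>2) / W"
      using W by (simp add: field_simps)
    then show ?thesis
      using W by (simp add: v_def g_def flip: W_def) (simp add: field_simps power2_eq_square)
  qed
  have 2: "(\<Sum>x\<in>S. w x * (f x)\<^sup>2) = (\<Sum>x\<in>S. v x * (g x)\<^sup>2)
      + (\<Sum>x\<in>S. w x * w (i x) / (w x + w (i x)) * (f x - f (i x))\<^sup>2) / 2"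
  proof -
    have "(\<Sum>x\<in>S. w x * (f x)\<^sup>2) = (\<Sum>x\<in>S. (w x * (f x)\<^sup>2 + w (i x) * (f (i x))\<^sup>2) / 2)"
      using inv[of "\<lambda>x. w x * (f x)\<^sup>2"] by (simp add: sum.distrib flip: sum_divide_distrib)
    also have "\<dots> = (\<Sum>x\<in>S. v x * (g x)\<^sup>2
        + w x * w (i x) / (w x + w (i x)) * (f x - f (i x))\<^sup>2 / 2)"
      by (intro sum.cong refl *)
    finally show ?thesis
      by (simp only: sum.distrib sum_divide_distrib)
  qed
  have "(\<Sum>x\<in>S. v x * g x)\<^sup>2 \<le> (\<Sum>x\<in>S. v x * (g x)\<^sup>2)"
    using weighted_square_le[of S v g] v_pos v_sum by (simp add: less_imp_le)
  with 1 2 show ?thesis by simp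
qed

definition variance_on :: "'s set \<Rightarrow> ('s \<Rightarrow> real) \<Rightarrow> ('s \<Rightarrow> real) \<Rightarrow> real" where
  "variance_on S p f = (\<Sum>\<sigma>\<in>S. p \<sigma> * (f \<sigma>)\<^sup>2) - (\<Sum>\<sigma>\<in>S. p \<sigma> * f \<sigma>)\<^sup>2"

definition kernel_op :: "'s set \<Rightarrow> ('s \<Rightarrow> 's \<Rightarrow> real) \<Rightarrow> ('s \<Rightarrow> real) \<Rightarrow> 's \<Rightarrow> real" where
  "kernel_op S M f \<sigma> = (\<Sum>\<tau>\<in>S. M \<sigma> \<tau> * f \<tau>)"

lemma variance_on_eq_sum_squares:
  assumes "sum p S = 1"
  shows "variance_on S p f = (\<Sum>\<sigma>\<in>S. p \<sigma> * (f \<sigma> - (\<Sum>\<tau>\<in>S. p \<tau> * f \<tau>))\<^sup>2)"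
proof -
  define m where "m = (\<Sum>\<tau>\<in>S. p \<tau> * f \<tau>)"
  have "(\<Sum>\<sigma>\<in>S. p \<sigma> * (f \<sigma> - m)\<^sup>2) = (\<Sum>\<sigma>\<in>S. p \<sigma> * (f \<sigma>)\<^sup>2 - 2 * m * (p \<sigma> * f \<sigma>) + m\<^sup>2 * p \<sigma>)"
    by (intro sum.cong) (auto simp: power2_eq_square algebra_simps)
  also have "\<dots> = (\<Sum>\<sigma>\<in>S. p \<sigma> * (f \<sigma>)\<^sup>2) - 2 * m * m + m\<^sup>2"
    using assms by (simp add: sum.distrib sum_subtractf m_def flip: sum_distrib_left)
  finally show ?thesis by (simp add: variance_on_def m_def power2_eq_square)
qed

lemma variance_on_eq_pairs:
  assumes "sum p S = 1"
  shows "variance_on S p f = (\<Sum>\<sigma>\<in>S. \<Sum>\<tau>\<in>S. p \<sigma> * p \<tau> * (f \<tau> - f \<sigma>)\<^sup>2) / 2"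
proof -
  define m where "m = (\<Sum>\<tau>\<in>S. p \<tau> * f \<tau>)"
  define s where "s = (\<Sum>\<tau>\<in>S. p \<tau> * (f \<tau>)\<^sup>2)"
  have "(\<Sum>\<tau>\<in>S. p \<sigma> * p \<tau> * (f \<tau> - f \<sigma>)\<^sup>2) = p \<sigma> * s - 2 * m * (p \<sigma> * f \<sigma>) + p \<sigma> * (f \<sigma>)\<^sup>2" for \<sigma>
  proof -
    have "(\<Sum>\<tau>\<in>S. p \<sigma> * p \<tau> * (f \<tau> - f \<sigma>)\<^sup>2)
      = (\<Sum>\<tau>\<in>S. p \<sigma> * (p \<tau> * (f \<tau>)\<^sup>2) - 2 * (p \<sigma> * f \<sigma>) * (p \<tau> * f \<tau>) + p \<sigma> * (f \<sigma>)\<^sup>2 * p \<tau>)"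
      by (intro sum.cong) (auto simp: power2_eq_square algebra_simps)
    also have "\<dots> = p \<sigma> * s - 2 * (p \<sigma> * f \<sigma>) * m + p \<sigma> * (f \<sigma>)\<^sup>2"
      using assms by (simp add: sum.distrib sum_subtractf m_def s_def flip: sum_distrib_left)
    finally show ?thesis by simp
  qed
  then have "(\<Sum>\<sigma>\<in>S. \<Sum>\<tau>\<in>S. p \<sigma> * p \<tau> * (f \<tau> - f \<sigma>)\<^sup>2)
    = (\<Sum>\<sigma>\<in>S. p \<sigma> * s - 2 * m * (p \<sigma> * f \<sigma>) + p \<sigma> * (f \<sigma>)\<^sup>2)" by simp
  also have "\<dots> = 1 * s - 2 * m * m + s"
    unfolding sum.distrib sum_subtractf sum_distrib_left[symmetric] sum_distrib_right[symmetric]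
    by (simp add: assms m_def s_def)
  finally show ?thesis by (simp add: variance_on_def power2_eq_square[of m] flip: m_def s_def)
qed

section \<open>Powers of a kernel and decay of the variance\<close>

lemma kernel_op_mat_pow_0:
  assumes "finite S" and "\<sigma> \<in> S"
  shows "kernel_op S (mat_pow S M 0) f \<sigma> = f \<sigma>"
proof -
  have "kernel_op S (mat_pow S M 0) f \<sigma> = (\<Sum>\<tau>\<in>S. if \<sigma> = \<tau> then f \<tau> else 0)"
    unfolding kernel_op_def by (intro sum.cong) auto
  then show ?thesis using assms by simp
qed

text \<open>The additional factor of the power acts on \<open>f\<close> first, so inductions over
  \<open>t\<close> keep \<open>f\<close> arbitrary.\<close>

lemma kernel_op_mat_pow_Suc:
  assumes "finite S"
  shows "kernel_op S (mat_pow S M (Suc t)) f \<sigma> = kernel_op S (mat_pow S M t) (kernel_op S M f) \<sigma>"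
proof -
  have "kernel_op S (mat_pow S M (Suc t)) f \<sigma>
    = (\<Sum>\<tau>\<in>S. \<Sum>\<rho>\<in>S. mat_pow S M t \<sigma> \<rho> * M \<rho> \<tau> * f \<tau>)"
    by (simp add: kernel_op_def sum_distrib_right)
  also have "\<dots> = (\<Sum>\<rho>\<in>S. \<Sum>\<tau>\<in>S. mat_pow S M t \<sigma> \<rho> * M \<rho> \<tau> * f \<tau>)"
    by (rule sum.swap)
  finally show ?thesis by (simp add: kernel_op_def sum_distrib_left mult.assoc)
qed

text \<open>When the rows of \<open>M\<close> are probability vectors, the right-hand side of
  \<open>poincare\<close> is the mean variance of \<open>f\<close> under these rows. The bound
  \<open>l \<le> 1\<close> keeps the powers of \<open>1 - l\<close> nonnegative.\<close>

locale poincare_chain =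
  fixes S :: "'s set" and M :: "'s \<Rightarrow> 's \<Rightarrow> real" and p :: "'s \<Rightarrow> real" and l :: real
  assumes finite_S: "finite S"
    and p_pos: "\<And>\<sigma>. \<sigma> \<in> S \<Longrightarrow> 0 < p \<sigma>"
    and p_sum: "sum p S = 1"
    and stationary: "\<And>\<tau>. \<tau> \<in> S \<Longrightarrow> (\<Sum>\<sigma>\<in>S. p \<sigma> * M \<sigma> \<tau>) = p \<tau>"
    and l_le: "l \<le> 1"
    and poincare: "\<And>f. l * variance_on S p f
      \<le> (\<Sum>\<sigma>\<in>S. p \<sigma> * (kernel_op S M (\<lambda>\<tau>. (f \<tau>)\<^sup>2) \<sigma> - (kernel_op S M f \<sigma>)\<^sup>2))"
begin

lemma mean_kernel_op: "(\<Sum>\<sigma>\<in>S. p \<sigma> * kernel_op S M f \<sigma>) = (\<Sum>\<sigma>\<in>S. p \<sigma> * f \<sigma>)"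
proof -
  have "(\<Sum>\<sigma>\<in>S. p \<sigma> * kernel_op S M f \<sigma>) = (\<Sum>\<sigma>\<in>S. \<Sum>\<tau>\<in>S. p \<sigma> * M \<sigma> \<tau> * f \<tau>)"
    by (simp add: kernel_op_def sum_distrib_left mult.assoc)
  also have "\<dots> = (\<Sum>\<tau>\<in>S. (\<Sum>\<sigma>\<in>S. p \<sigma> * M \<sigma> \<tau>) * f \<tau>)"
    by (subst sum.swap) (simp add: sum_distrib_right)
  finally show ?thesis by (simp add: stationary)
qed

text \<open>By stationarity \<open>f\<close> and \<open>kernel_op S M f\<close> have the same mean,
  and averaging the image of the square of \<open>f\<close> gives back the second moment of
  \<open>f\<close>. So the right-hand side of \<open>poincare\<close> is exactly the variance lost
  in one step.\<close>

lemma variance_kernel_op: "variance_on S p (kernel_op S M f) \<le> (1 - l) * variance_on S p f"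
  using poincare[of f] mean_kernel_op[of "\<lambda>\<tau>. (f \<tau>)\<^sup>2"] mean_kernel_op[of f]
  by (simp add: variance_on_def right_diff_distrib sum_subtractf left_diff_distrib)

lemma mean_mat_pow:
  "(\<Sum>\<sigma>\<in>S. p \<sigma> * kernel_op S (mat_pow S M t) f \<sigma>) = (\<Sum>\<sigma>\<in>S. p \<sigma> * f \<sigma>)"
proof (induction t arbitrary: f)
  case 0
  show ?case by (intro sum.cong) (simp_all only: kernel_op_mat_pow_0[OF finite_S])
next
  case (Suc t)
  then show ?case by (simp only: kernel_op_mat_pow_Suc[OF finite_S] mean_kernel_op)
qed

lemma variance_mat_pow:
  "variance_on S p (kernel_op S (mat_pow S M t) f) \<le> (1 - l) ^ t * variance_on S p f"
proof (induction t arbitrary: f)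
  case 0
  show ?case
    by (simp add: variance_on_def kernel_op_mat_pow_0[OF finite_S] del: mat_pow.simps)
next
  case (Suc t)
  have "variance_on S p (kernel_op S (mat_pow S M (Suc t)) f)
      = variance_on S p (kernel_op S (mat_pow S M t) (kernel_op S M f))"
    by (simp only: variance_on_def kernel_op_mat_pow_Suc[OF finite_S])
  also have "\<dots> \<le> (1 - l) ^ t * variance_on S p (kernel_op S M f)" by (rule Suc)
  also have "\<dots> \<le> (1 - l) ^ t * ((1 - l) * variance_on S p f)"
    using l_le by (intro mult_left_mono variance_kernel_op) simp
  finally show ?case by (simp only: power_Suc ac_simps)
qed

text \<open>The decay is applied to the indicator of \<open>A\<close>, whose variance is at most 1.
  Keeping only the term of the starting state \<sigma> in the variance at time \<open>t\<close>
  bounds the deviation for each single start, at the price of the factor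
  \<open>p \<sigma>\<close>.\<close>

lemma event_deviation:
  assumes "\<sigma> \<in> S" and "A \<subseteq> S"
  shows "p \<sigma> * (sum (mat_pow S M t \<sigma>) A - sum p A)\<^sup>2 \<le> (1 - l) ^ t"
proof -
  define f :: "'s \<Rightarrow> real" where "f \<tau> = of_bool (\<tau> \<in> A)" for \<tau>
  have ind: "(\<Sum>\<tau>\<in>S. g \<tau> * f \<tau>) = sum g A" for g :: "'s \<Rightarrow> real"
  proof -
    have "(\<Sum>\<tau>\<in>S. g \<tau> * f \<tau>) = (\<Sum>\<tau>\<in>S. if \<tau> \<in> A then g \<tau> else 0)"
      by (intro sum.cong) (auto simp: f_def)
    then show ?thesis
      using assms(2) finite_S by (simp add: sum.inter_restrict[symmetric] Int_absorb1)
  qed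
  have k: "kernel_op S (mat_pow S M t) f \<rho> = sum (mat_pow S M t \<rho>) A" for \<rho>
    by (simp add: kernel_op_def ind)
  have "p \<sigma> * (kernel_op S (mat_pow S M t) f \<sigma> - sum p A)\<^sup>2
      \<le> (\<Sum>\<rho>\<in>S. p \<rho> * (kernel_op S (mat_pow S M t) f \<rho> - sum p A)\<^sup>2)"
    using assms(1) finite_S p_pos by (intro member_le_sum) (auto simp: less_imp_le)
  also have "\<dots> = variance_on S p (kernel_op S (mat_pow S M t) f)"
    by (simp add: variance_on_eq_sum_squares[OF p_sum] mean_mat_pow ind)
  also have "\<dots> \<le> (1 - l) ^ t * variance_on S p f" by (rule variance_mat_pow)
  also have "\<dots> \<le> (1 - l) ^ t * 1"
  proof (rule mult_left_mono)
    have "variance_on S p f \<le> (\<Sum>\<tau>\<in>S. p \<tau> * (f \<tau>)\<^sup>2)"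
      by (simp add: variance_on_def)
    also have "\<dots> \<le> (\<Sum>\<tau>\<in>S. p \<tau> * 1)"
      using p_pos by (intro sum_mono mult_left_mono) (auto simp: f_def less_imp_le)
    finally show "variance_on S p f \<le> 1" by (simp add: p_sum)
  qed (use l_le in simp)
  finally show ?thesis by (simp add: k)
qed

end

section \<open>Gibbs weights and the stationary measure\<close>

lemma finite_torus [simp]: "finite (torus L)"
  by (simp add: torus_def)

lemma card_torus: "card (torus L) = L\<^sup>2"
  by (simp add: torus_def power2_eq_square)

lemma neighbour_torus [simp]:
  assumes "x \<in> torus L"
  shows "up L x \<in> torus L" "right L x \<in> torus L" "down L x \<in> torus L" "left L x \<in> torus L"
  using assms by (auto simp: torus_def up_def right_def down_def left_def)

lemma right_left:
  assumes "x \<in> torus L"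
  shows "right L (left L x) = x"
  using assms by (auto simp: torus_def right_def left_def mod_simps)

lemma finite_configs [simp]: "finite (configs L)"
  by (auto simp: configs_def intro: finite_PiE)

lemma configs_nonempty: "configs L \<noteq> {}"
  by (simp add: configs_def PiE_eq_empty_iff)

lemma config_spin: "\<sigma> \<in> configs L \<Longrightarrow> x \<in> torus L \<Longrightarrow> \<sigma> x = -1 \<or> \<sigma> x = 1"
  by (auto simp: configs_def)

lemma sum_configs_prod:
  "(\<Sum>\<sigma>\<in>configs L. \<Prod>x\<in>torus L. g x (\<sigma> x)) = (\<Prod>x\<in>torus L. g x (-1) + g x 1 :: real)"
  using prod_sum_PiE[of "torus L" "\<lambda>_. {-1, 1}" g] by (simp add: configs_def)

lemma card_configs: "card (configs L) = 2 ^ L\<^sup>2"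
  by (simp add: configs_def card_PiE card_torus numeral_2_eq_2)

definition flip :: "site \<Rightarrow> config \<Rightarrow> config" where
  "flip x \<sigma> = \<sigma>(x := - \<sigma> x)"

lemma flip_flip [simp]: "flip x (flip x \<sigma>) = \<sigma>"
  by (simp add: flip_def)

lemma flip_configs [simp]: "\<sigma> \<in> configs L \<Longrightarrow> x \<in> torus L \<Longrightarrow> flip x \<sigma> \<in> configs L"
  using config_spin[of \<sigma> L x] by (auto simp: configs_def flip_def PiE_iff extensional_def)

section \<open>Local fields, factorisation of the partition function, stationarity\<close>

context
  fixes L :: nat and J q :: real
begin

text \<open>The exponent \<open>- H\<close> is linear in each argument:
  \<open>field_in \<sigma>\<close> collects the coefficients of the spins of \<tau>, and
  \<open>field_out \<tau>\<close> those of the spins of \<sigma>. Hence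
  \<open>P L J q \<sigma>\<close> is a product measure over the sites.\<close>

definition field_in :: "config \<Rightarrow> site \<Rightarrow> real" where
  "field_in \<sigma> x = J * (\<sigma> (down L x) + \<sigma> (left L x)) + q * \<sigma> x"

definition field_out :: "config \<Rightarrow> site \<Rightarrow> real" where
  "field_out \<tau> x = J * (\<tau> (up L x) + \<tau> (right L x)) + q * \<tau> x"

lemma H_eq_field_in: "H L J q \<sigma> \<tau> = - (\<Sum>x\<in>torus L. \<tau> x * field_in \<sigma> x)"
  unfolding H_alt field_in_def by (simp add: algebra_simps)

lemma H_eq_field_out: "H L J q \<sigma> \<tau> = - (\<Sum>x\<in>torus L. \<sigma> x * field_out \<tau> x)"
  unfolding H_def field_out_def by (simp add: algebra_simps)

lemma sum_exp_linear:
  "(\<Sum>\<sigma>\<in>configs L. exp (\<Sum>x\<in>torus L. \<sigma> x * h x)) = (\<Prod>x\<in>torus L. 2 * cosh (h x :: real))"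
proof -
  have "2 * cosh (h x) = exp (- 1 * h x) + exp (1 * h x)" for x
    by (simp add: cosh_field_def)
  then show ?thesis
    using sum_configs_prod[of "\<lambda>x s. exp (s * h x)" L] by (simp only: exp_sum[OF finite_torus])
qed

lemma Z_eq_prod: "Z L J q \<sigma> = (\<Prod>x\<in>torus L. 2 * cosh (field_in \<sigma> x))"
  by (simp add: Z_def H_eq_field_in sum_exp_linear)

lemma sum_exp_H_left:
  "(\<Sum>\<sigma>\<in>configs L. exp (- H L J q \<sigma> \<tau>)) = (\<Prod>x\<in>torus L. 2 * cosh (field_out \<tau> x))"
  by (simp add: H_eq_field_out sum_exp_linear)

text \<open>Since cosh is even, only three values occur: at \<open>2 * J + q\<close>,
  \<open>2 * J - q\<close> and \<open>q\<close>. They correspond to the values (1, 2), (1, -2) and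
  (-1, 0) of the pair (a b, s a + s b), so the logarithm is found by solving three linear equations
  for three coefficients.\<close>

lemma cosh_spins:
  obtains \<alpha> \<beta> \<gamma> where "\<And>a b s. \<lbrakk>a = -1 \<or> a = 1; b = -1 \<or> b = 1; s = -1 \<or> s = 1\<rbrakk> \<Longrightarrow>
    cosh (J * (a + b) + q * s) = exp (\<alpha> + \<beta> * (a * b) + \<gamma> * (s * a + s * b))"
proof -
  define u where "u = ln (cosh (2 * J + q))"
  define v where "v = ln (cosh (2 * J - q))"
  define w where "w = ln (cosh q)"
  define \<alpha> where "\<alpha> = ((u + v) / 2 + w) / 2"
  define \<beta> where "\<beta> = ((u + v) / 2 - w) / 2"
  define \<gamma> where "\<gamma> = (u - v) / 4"
  have e: "\<alpha> + \<beta> + 2 * \<gamma> = u" "\<alpha> + \<beta> - 2 * \<gamma> = v" "\<alpha> - \<beta> = w"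
    by (simp_all add: \<alpha>_def \<beta>_def \<gamma>_def field_simps)
  have c: "exp u = cosh (2 * J + q)" "exp v = cosh (2 * J - q)" "exp w = cosh q"
    by (simp_all add: u_def v_def w_def)
  have n: "cosh (- (2 * J) - q) = cosh (2 * J + q)" "cosh (q - 2 * J) = cosh (2 * J - q)"
    using cosh_minus[of "2 * J + q"] cosh_minus[of "2 * J - q"] by (simp_all add: algebra_simps)
  show thesis
    by (rule that[of \<alpha> \<beta> \<gamma>]; elim disjE; simp add: e c n algebra_simps)
      (use e c n in \<open>simp_all add: algebra_simps\<close>)
qed

text \<open>\<open>cosh (J (a + b) + q s)\<close> is the exponential of an affine function of \<open>a b\<close> and
  \<open>s (a + b)\<close>, and the sums over the torus of these two products do not change when the pair
  (down, left) is replaced by (up, right).\<close>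

lemma Z_eq_prod_field_out:
  assumes "\<tau> \<in> configs L"
  shows "Z L J q \<tau> = (\<Prod>x\<in>torus L. 2 * cosh (field_out \<tau> x))"
proof -
  obtain \<alpha> \<beta> \<gamma> where c: "\<And>a b s. \<lbrakk>a = -1 \<or> a = 1; b = -1 \<or> b = 1; s = -1 \<or> s = 1\<rbrakk> \<Longrightarrow>
    cosh (J * (a + b) + q * s) = exp (\<alpha> + \<beta> * (a * b) + \<gamma> * (s * a + s * b))"
    by (rule cosh_spins) blast
  have inn: "(\<Prod>x\<in>torus L. cosh (field_in \<tau> x))
    = exp (\<Sum>x\<in>torus L. \<alpha> + \<beta> * (\<tau> (down L x) * \<tau> (left L x))
        + \<gamma> * (\<tau> x * \<tau> (down L x) + \<tau> x * \<tau> (left L x)))"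
    unfolding exp_sum[OF finite_torus] field_in_def
    by (intro prod.cong refl c) (simp_all add: config_spin[OF assms])
  have out: "(\<Prod>x\<in>torus L. cosh (field_out \<tau> x))
    = exp (\<Sum>x\<in>torus L. \<alpha> + \<beta> * (\<tau> (up L x) * \<tau> (right L x))
        + \<gamma> * (\<tau> x * \<tau> (up L x) + \<tau> x * \<tau> (right L x)))"
    unfolding exp_sum[OF finite_torus] field_out_def
    by (intro prod.cong refl c) (simp_all add: config_spin[OF assms])
  have "(\<Sum>x\<in>torus L. \<tau> x * \<tau> (down L x)) = (\<Sum>x\<in>torus L. \<tau> x * \<tau> (up L x))"
    unfolding sum_torus_shift(1)[of "\<lambda>x. \<tau> x * \<tau> (down L x)", symmetric]
    by (rule sum.cong) (simp_all add: sum_torus_shift(3))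
  moreover have "(\<Sum>x\<in>torus L. \<tau> x * \<tau> (left L x)) = (\<Sum>x\<in>torus L. \<tau> x * \<tau> (right L x))"
    unfolding sum_torus_shift(2)[of "\<lambda>x. \<tau> x * \<tau> (left L x)", symmetric]
    by (rule sum.cong) (simp_all add: sum_torus_shift(4))
  moreover have "(\<Sum>x\<in>torus L. \<tau> (down L x) * \<tau> (left L x))
    = (\<Sum>x\<in>torus L. \<tau> (up L x) * \<tau> (right L x))"
  proof -
    have "down L (up L (right L x)) = right L x" "left L (up L (right L x)) = up L x"
      if "x \<in> torus L" for x
      using that by (auto simp: torus_def up_def right_def down_def left_def mod_simps)
    then show ?thesis
      unfolding sum_torus_shift(1)[of "\<lambda>x. \<tau> (down L x) * \<tau> (left L x)", symmetric]
        sum_torus_shift(2)[of "\<lambda>x. \<tau> (down L (up L x)) * \<tau> (left L (up L x))", symmetric]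
      by (intro sum.cong) (simp_all add: mult.commute)
  qed
  ultimately have "(\<Prod>x\<in>torus L. cosh (field_in \<tau> x)) = (\<Prod>x\<in>torus L. cosh (field_out \<tau> x))"
    unfolding inn out by (simp add: sum.distrib flip: sum_distrib_left)
  then show ?thesis by (simp add: Z_eq_prod prod.distrib)
qed

text \<open>The column sum of the weights \<open>exp (- H)\<close> equals the row sum at the same
  configuration. As \<open>pi_PCA\<close> is proportional to the row sums, this is the stationarity
  of \<open>pi_PCA\<close> without detailed balance.\<close>

lemma sum_exp_H_left_eq_Z:
  "\<tau> \<in> configs L \<Longrightarrow> (\<Sum>\<sigma>\<in>configs L. exp (- H L J q \<sigma> \<tau>)) = Z L J q \<tau>"
  by (simp add: sum_exp_H_left Z_eq_prod_field_out)

lemma Z_pos [simp]: "0 < Z L J q \<sigma>"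
  unfolding Z_def using configs_nonempty by (intro sum_pos) auto

lemma sum_Z_pos [simp]: "0 < (\<Sum>\<sigma>\<in>configs L. Z L J q \<sigma>)"
  using configs_nonempty by (intro sum_pos) auto

lemma Z_nonzero [simp]: "Z L J q \<sigma> \<noteq> 0"
  using Z_pos[of \<sigma>] by linarith

lemma sum_Z_nonzero [simp]: "(\<Sum>\<sigma>\<in>configs L. Z L J q \<sigma>) \<noteq> 0"
  using sum_Z_pos by linarith

lemma P_pos [simp]: "0 < P L J q \<sigma> \<tau>"
  by (simp add: P_def)

lemma sum_P: "(\<Sum>\<tau>\<in>configs L. P L J q \<sigma> \<tau>) = 1"
  using Z_pos[of \<sigma>] unfolding P_def by (simp add: Z_def flip: sum_divide_distrib)

lemma pi_PCA_pos [simp]: "0 < pi_PCA L J q \<sigma>"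
  by (simp add: pi_PCA_def)

lemma sum_pi_PCA: "(\<Sum>\<sigma>\<in>configs L. pi_PCA L J q \<sigma>) = 1"
  unfolding pi_PCA_def by (simp flip: sum_divide_distrib)

lemma pi_PCA_P:
  "pi_PCA L J q \<sigma> * P L J q \<sigma> \<tau> = exp (- H L J q \<sigma> \<tau>) / (\<Sum>\<sigma>'\<in>configs L. Z L J q \<sigma>')"
  by (simp add: pi_PCA_def P_def)

lemma pi_PCA_stationary:
  "\<tau> \<in> configs L \<Longrightarrow> (\<Sum>\<sigma>\<in>configs L. pi_PCA L J q \<sigma> * P L J q \<sigma> \<tau>) = pi_PCA L J q \<tau>"
  by (simp add: pi_PCA_P sum_exp_H_left_eq_Z flip: sum_divide_distrib) (simp add: pi_PCA_def)

section \<open>Single spin flips and their rates\<close>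

lemma sum_flip:
  assumes "x \<in> torus L"
  shows "(\<Sum>y\<in>torus L. flip x \<sigma> y * h y) = (\<Sum>y\<in>torus L. \<sigma> y * h y) - 2 * \<sigma> x * h x"
  using assms by (simp add: sum.remove[OF finite_torus assms] flip_def)

lemma exp_H_flip_right:
  "x \<in> torus L \<Longrightarrow>
    exp (- H L J q \<sigma> (flip x \<tau>)) = exp (- H L J q \<sigma> \<tau>) / exp (2 * \<tau> x * field_in \<sigma> x)"
  by (simp add: H_eq_field_in sum_flip exp_diff)

lemma exp_H_flip_left:
  "x \<in> torus L \<Longrightarrow>
    exp (- H L J q (flip x \<sigma>) \<tau>) = exp (- H L J q \<sigma> \<tau>) / exp (2 * \<sigma> x * field_out \<tau> x)"
  by (simp add: H_eq_field_out sum_flip exp_diff)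

end

text \<open>If \<open>\<eta>\<close> changes sign between \<open>x\<close> and its neighbour on the antidiagonal, the two strong
  couplings of \<open>z = left L x\<close> to \<open>\<eta>\<close> cancel, so that \<open>z\<close> is of either sign in the previous
  configuration with probability of order one; if its sign is opposite to \<open>\<eta> x\<close>, no strong
  force holds the spin at \<open>x\<close>.\<close>

lemma flip_rate_ge:
  fixes L :: nat and J q :: real
  assumes "0 \<le> J" and "0 \<le> q" and x: "x \<in> torus L" and \<eta>: "\<eta> \<in> configs L"
    and wall: "\<eta> x \<noteq> \<eta> (up L (left L x))"
  shows "pi_PCA L J q \<eta> / (1 + exp (2 * q))\<^sup>2 \<le> (\<Sum>\<sigma>\<in>configs L. pi_PCA L J q \<sigma> *
    (P L J q \<sigma> \<eta> * P L J q \<sigma> (flip x \<eta>) / (P L J q \<sigma> \<eta> + P L J q \<sigma> (flip x \<eta>))))"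
proof -
  define z where "z = left L x"
  define W where "W = (\<Sum>\<sigma>\<in>configs L. Z L J q \<sigma>)"
  define E where "E \<sigma> = exp (- H L J q \<sigma> \<eta>)" for \<sigma>
  define S where "S = {\<sigma>\<in>configs L. \<sigma> z = - \<eta> x}"
  have W: "0 < W" by (simp add: W_def)
  have E: "0 < E \<sigma>" for \<sigma> by (simp add: E_def)
  have z: "z \<in> torus L" using x by (simp add: z_def)
  have spin_x: "\<eta> x = -1 \<or> \<eta> x = 1" and spin_z: "\<eta> z = -1 \<or> \<eta> z = 1"
    and spin_u: "\<eta> (up L z) = -1 \<or> \<eta> (up L z) = 1"
    using x z by (simp_all add: config_spin[OF \<eta>])
  \<comment> \<open>\<open>right L z\<close> is \<open>x\<close>, so the wall makes the two terms
    with \<open>J\<close> cancel.\<close>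
  have field_z: "field_out L J q \<eta> z = q * \<eta> z"
    using wall spin_x spin_u right_left[OF x] by (auto simp: field_out_def z_def)
  \<comment> \<open>Flipping \<open>z\<close> maps the complement of \<open>S\<close> onto
    \<open>S\<close>. Only the weak field acts on \<open>z\<close>, so the weight changes by a
    factor of at most \<open>exp (2 * q)\<close>.\<close>
  have sum_le: "Z L J q \<eta> \<le> (1 + exp (2 * q)) * sum E S"
  proof -
    have "sum E (configs L - S) = (\<Sum>\<sigma>\<in>S. E (flip z \<sigma>))"
    proof (rule sum.reindex_bij_witness[of _ "flip z" "flip z"])
      fix \<sigma> assume "\<sigma> \<in> configs L - S"
      then have "\<sigma> \<in> configs L" "\<sigma> z \<noteq> - \<eta> x" by (auto simp: S_def)
      then show "flip z \<sigma> \<in> S"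
        using spin_x config_spin[of \<sigma> L z] flip_configs[of \<sigma> L z] z
        by (auto simp: S_def flip_def)
    next
      fix \<sigma> assume "\<sigma> \<in> S"
      then show "flip z \<sigma> \<in> configs L - S"
        using spin_x flip_configs[of \<sigma> L z] z by (auto simp: S_def flip_def)
    qed simp_all
    also have "\<dots> \<le> (\<Sum>\<sigma>\<in>S. exp (2 * q) * E \<sigma>)"
    proof (rule sum_mono)
      fix \<sigma> assume "\<sigma> \<in> S"
      then have "\<sigma> z = - \<eta> x" by (simp add: S_def)
      then have "- (2 * \<sigma> z * field_out L J q \<eta> z) \<le> 2 * q"
        using spin_x spin_z \<open>0 \<le> q\<close> by (auto simp: field_z)
      then have "exp (- (2 * \<sigma> z * field_out L J q \<eta> z)) \<le> exp (2 * q)" by simp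
      then have "E \<sigma> * exp (- (2 * \<sigma> z * field_out L J q \<eta> z)) \<le> E \<sigma> * exp (2 * q)"
        using E[of \<sigma>] by (intro mult_left_mono) (auto simp: less_imp_le)
      then show "E (flip z \<sigma>) \<le> exp (2 * q) * E \<sigma>"
        unfolding E_def exp_H_flip_left[OF z] by (simp add: exp_minus field_simps)
    qed
    finally have "sum E (configs L - S) \<le> exp (2 * q) * sum E S"
      by (simp add: sum_distrib_left)
    moreover have "Z L J q \<eta> = sum E (configs L - S) + sum E S"
      unfolding sum_exp_H_left_eq_Z[OF \<eta>, symmetric] E_def
      by (rule sum.subset_diff) (auto simp: S_def)
    ultimately show ?thesis by (simp add: algebra_simps)
  qed
  \<comment> \<open>Of the two factors \<open>1 + exp (2 * q)\<close>, one pays for restricting the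
    sum to \<open>S\<close>; the other is left to bound the rate of the flip at
    \<open>x\<close>.\<close>
  have "pi_PCA L J q \<eta> / (1 + exp (2 * q))\<^sup>2 \<le> sum E S / (W * (1 + exp (2 * q)))"
  proof -
    have "0 < 1 + exp (2 * q)" by (simp add: add_pos_pos)
    moreover have "pi_PCA L J q \<eta> = Z L J q \<eta> / W" by (simp add: pi_PCA_def W_def)
    moreover have "Z L J q \<eta> / W / (1 + exp (2 * q))\<^sup>2 \<le> (1 + exp (2 * q)) * sum E S / W / (1 + exp (2 * q))\<^sup>2"
      using sum_le W by (intro divide_right_mono) auto
    ultimately show ?thesis by (simp add: power2_eq_square mult.commute)
  qed
  also have "\<dots> = (\<Sum>\<sigma>\<in>S. E \<sigma> / (W * (1 + exp (2 * q))))"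
    by (simp add: sum_divide_distrib)
  also have "\<dots> \<le> (\<Sum>\<sigma>\<in>S. pi_PCA L J q \<sigma> *
    (P L J q \<sigma> \<eta> * P L J q \<sigma> (flip x \<eta>) / (P L J q \<sigma> \<eta> + P L J q \<sigma> (flip x \<eta>))))"
  proof (rule sum_mono)
    fix \<sigma> assume "\<sigma> \<in> S"
    then have \<sigma>: "\<sigma> \<in> configs L" "\<sigma> z = - \<eta> x" by (auto simp: S_def)
    define h where "h = 2 * \<eta> x * field_in L J q \<sigma> x"
    have "\<sigma> (down L x) = -1 \<or> \<sigma> (down L x) = 1" "\<sigma> x = -1 \<or> \<sigma> x = 1"
      using x by (simp_all add: config_spin[OF \<sigma>(1)])
    \<comment> \<open>The left neighbour \<open>z\<close> of \<open>x\<close> carries the sign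
      opposite to \<open>\<eta> x\<close>, so the part of \<open>h\<close> with \<open>J\<close> is
      at most 0 whatever the spin below \<open>x\<close>.\<close>
    then have "h \<le> 2 * q"
      using spin_x \<sigma>(2) assms(1,2) by (auto simp: h_def field_in_def z_def)
    have r: "P L J q \<sigma> (flip x \<eta>) = P L J q \<sigma> \<eta> / exp h"
      unfolding P_def exp_H_flip_right[OF x] by (simp add: h_def)
    define p where "p = P L J q \<sigma> \<eta>"
    have "0 < p" by (simp add: p_def)
    have "p * (p / exp h) / (p + p / exp h) = p * (1 / (1 + exp h))"
    proof -
      have "p + p / exp h = p * (1 + exp h) / exp h" by (simp add: field_simps)
      then show ?thesis using \<open>0 < p\<close> by simp
    qed
    then have "pi_PCA L J q \<sigma> * (P L J q \<sigma> \<eta> * P L J q \<sigma> (flip x \<eta>) / (P L J q \<sigma> \<eta> + P L J q \<sigma> (flip x \<eta>)))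
        = E \<sigma> / (W * (1 + exp h))"
      using pi_PCA_P[of L J q \<sigma> \<eta>] unfolding r p_def[symmetric] W_def[symmetric] E_def[symmetric]
      by (simp add: mult.assoc[symmetric])
    also have "\<dots> \<ge> E \<sigma> / (W * (1 + exp (2 * q)))"
      using \<open>h \<le> 2 * q\<close> W E[of \<sigma>] by (intro divide_left_mono mult_left_mono mult_pos_pos add_pos_pos) auto
    finally show "E \<sigma> / (W * (1 + exp (2 * q))) \<le> pi_PCA L J q \<sigma> *
      (P L J q \<sigma> \<eta> * P L J q \<sigma> (flip x \<eta>) / (P L J q \<sigma> \<eta> + P L J q \<sigma> (flip x \<eta>)))" .
  qed
  also have "\<dots> \<le> (\<Sum>\<sigma>\<in>configs L. pi_PCA L J q \<sigma> *
    (P L J q \<sigma> \<eta> * P L J q \<sigma> (flip x \<eta>) / (P L J q \<sigma> \<eta> + P L J q \<sigma> (flip x \<eta>))))"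
    by (intro sum_mono2) (auto simp: S_def less_imp_le)
  finally show ?thesis .
qed


section \<open>Canonical paths along antidiagonals\<close>

definition site_index :: "nat \<Rightarrow> site \<Rightarrow> nat" where
  "site_index L x = nat ((fst x + snd x) mod int L) * L + nat (fst x)"

definition initial_sites :: "nat \<Rightarrow> nat \<Rightarrow> site set" where
  "initial_sites L m = {x \<in> torus L. site_index L x < m}"

text \<open>The antidiagonal and the abscissa are the two digits of the index in base
  \<open>L\<close>, so the order is lexicographic. Thus \<open>initial_sites L m\<close> consists of
  the antidiagonals below \<open>m div L\<close> and the first \<open>m mod L\<close> sites of the
  next one.\<close>

lemma site_index_less_iff:
  assumes "x \<in> torus L" and "0 < L"
  shows "site_index L x < m \<longleftrightarrow>
    nat ((fst x + snd x) mod int L) < m div L \<or>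
    nat ((fst x + snd x) mod int L) = m div L \<and> nat (fst x) < m mod L"
proof -
  define d where "d = nat ((fst x + snd x) mod int L)"
  define i where "i = nat (fst x)"
  have i: "i < L" using assms by (auto simp: i_def torus_def)
  have m: "m = m div L * L + m mod L" by simp
  have r: "m mod L < L" using assms by simp
  have "d * L + i < m div L * L + m mod L \<longleftrightarrow> d < m div L \<or> d = m div L \<and> i < m mod L"
  proof (cases "d" "m div L" rule: linorder_cases)
    case less
    then have "Suc d * L \<le> m div L * L" by (intro mult_le_mono1) simp
    then have "d * L + i < m div L * L + m mod L" using i unfolding mult_Suc by linarith
    then show ?thesis using less by blast
  next
    case greater
    then have "Suc (m div L) * L \<le> d * L" by (intro mult_le_mono1) simp
    then have "\<not> d * L + i < m div L * L + m mod L" using r unfolding mult_Suc by linarith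
    then show ?thesis using greater by simp
  next
    case equal
    then show ?thesis by (simp only: add_less_cancel_left less_irrefl simp_thms)
  qed
  then show ?thesis using m by (simp add: site_index_def d_def i_def)
qed

lemma diagonal_inj:
  assumes "x \<in> torus L" "y \<in> torus L" "fst x = fst y"
    and "(fst x + snd x) mod int L = (fst y + snd y) mod int L"
  shows "x = y"
proof -
  have "((fst x + snd x) - fst x) mod int L = ((fst y + snd y) - fst y) mod int L"
    using assms(3,4) by (intro mod_diff_cong) auto
  then show ?thesis using assms by (auto simp: torus_def prod_eq_iff)
qed

lemma bij_betw_site_index:
  assumes "0 < L"
  shows "bij_betw (site_index L) (torus L) {..<L\<^sup>2}"
proof -
  have inj: "inj_on (site_index L) (torus L)"
  proof (rule inj_onI)
    fix x y assume x: "x \<in> torus L" and y: "y \<in> torus L" and eq: "site_index L x = site_index L y"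
    have i: "nat (fst x) < L" "nat (fst y) < L" using x y by (auto simp: torus_def)
    have "site_index L x mod L = nat (fst x)" "site_index L y mod L = nat (fst y)"
      using i by (simp_all add: site_index_def)
    moreover have "site_index L x div L = nat ((fst x + snd x) mod int L)"
      "site_index L y div L = nat ((fst y + snd y) mod int L)"
      using i assms by (simp_all add: site_index_def)
    ultimately have "nat (fst x) = nat (fst y)"
      "nat ((fst x + snd x) mod int L) = nat ((fst y + snd y) mod int L)"
      using eq by simp_all
    then show "x = y"
      using x y assms by (intro diagonal_inj[of x L y]) (auto simp: torus_def nat_eq_iff2 nat_eq_iff)
  qed
  have "site_index L x < L\<^sup>2" if "x \<in> torus L" for x
    using that assms by (simp add: site_index_less_iff power2_eq_square nat_less_iff)
  then have "site_index L ` torus L = {..<L\<^sup>2}"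
    using inj by (intro card_subset_eq) (auto simp: card_image card_torus)
  with inj show ?thesis by (simp add: bij_betw_def)
qed

text \<open>In the coordinates \<open>(d, i)\<close> = (antidiagonal, abscissa) the left and down neighbours of
  \<open>(d, i)\<close> are \<open>(d - 1, i - 1)\<close> and \<open>(d - 1, i)\<close>.\<close>

lemma diagonal_neighbours:
  "(fst (left L x) + snd (left L x)) mod int L = ((fst x + snd x) mod int L - 1) mod int L"
  "(fst (down L x) + snd (down L x)) mod int L = ((fst x + snd x) mod int L - 1) mod int L"
  by (simp_all add: left_def down_def mod_simps algebra_simps)

text \<open>The left and down neighbours of \<open>y\<close> are cyclically adjacent on one
  antidiagonal, with abscissas \<open>fst y - 1\<close> and \<open>fst y\<close>. Only the
  antidiagonal \<open>m div L\<close> can be updated in part, and its updated segment ends at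
  abscissa \<open>m mod L\<close> and at the wrap-around 0. All such \<open>y\<close> lie on the
  following antidiagonal, so the abscissa determines \<open>y\<close>.\<close>

lemma card_split_sites:
  assumes "0 < L"
  shows "card {y \<in> torus L. (left L y \<in> initial_sites L m) \<noteq> (down L y \<in> initial_sites L m)} \<le> 2"
    (is "card ?C \<le> 2")
proof -
  define i where "i = int (m mod L)"
  have *: "(fst y + snd y) mod int L = int (Suc (m div L)) mod int L \<and> fst y \<in> {0, i}" if "y \<in> ?C" for y
  proof -
    define d where "d = (fst y + snd y) mod int L"
    define e where "e = nat ((d - 1) mod int L)"
    have y: "y \<in> torus L" and
      ne: "(site_index L (left L y) < m) \<noteq> (site_index L (down L y) < m)"
      using that by (auto simp: initial_sites_def)
    have d: "0 \<le> d" "d < int L" using assms by (simp_all add: d_def)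
    have e: "e = m div L" and f: "(nat ((fst y - 1) mod int L) < m mod L) \<noteq> (nat (fst y) < m mod L)"
      using ne y assms
      by (auto simp: site_index_less_iff diagonal_neighbours simp flip: d_def e_def)
        (auto simp: left_def down_def)
    have "int (Suc e) mod int L = ((d - 1) mod int L + 1) mod int L"
      using assms by (simp add: e_def add.commute)
    also have "\<dots> = d" using d by (simp add: mod_simps)
    finally have "d = int (Suc (m div L)) mod int L" by (simp add: e)
    moreover have "fst y \<in> {0, i}"
    proof (cases "fst y = 0")
      case False
      have "0 \<le> fst y" "fst y < int L" using y by (auto simp: torus_def)
      with False have "(fst y - 1) mod int L = fst y - 1" by simp
      then show ?thesis using f \<open>0 \<le> fst y\<close> False by (auto simp: i_def)
    qed simp
    ultimately show ?thesis by (simp add: d_def)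
  qed
  have "card ?C \<le> card {0, i}"
  proof (rule card_inj_on_le)
    show "inj_on fst ?C"
      using * by (intro inj_onI diagonal_inj[of _ L]) auto
  qed (use * in auto)
  also have "\<dots> \<le> 2" by (simp add: card_insert_if)
  finally show ?thesis .
qed

text \<open>\<open>X\<close> is the antidiagonal 0, whose predecessor is the last one by
  periodicity. \<open>Y\<close> is the front of the updated part: the rest of the partial
  antidiagonal and the sites after its updated segment. The two pieces of \<open>Y\<close> have
  disjoint ranges of abscissas, so each of \<open>X\<close> and \<open>Y\<close> has at most
  \<open>L\<close> sites.\<close>

lemma card_boundary_sites:
  assumes "0 < L"
  shows "card {y \<in> torus L. (left L y \<in> initial_sites L m) = (down L y \<in> initial_sites L m) \<and>
    (y \<in> initial_sites L m) \<noteq> (down L y \<in> initial_sites L m)} \<le> 2 * L"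
    (is "card ?D \<le> _")
proof -
  define D where "D = int (m div L)"
  define i where "i = int (m mod L)"
  define X where "X = {y \<in> torus L. (fst y + snd y) mod int L = 0}"
  define Y where "Y = {y \<in> torus L. (fst y + snd y) mod int L = D \<and> i \<le> fst y \<or>
     (fst y + snd y) mod int L = D + 1 \<and> fst y < i}"
  have X: "card X \<le> L"
  proof -
    have "card X \<le> card {0..<int L}"
    proof (rule card_inj_on_le)
      show "inj_on fst X" by (intro inj_onI diagonal_inj[of _ L]) (auto simp: X_def)
    qed (auto simp: X_def torus_def)
    then show ?thesis by simp
  qed
  have Y: "card Y \<le> L"
  proof -
    have "card Y \<le> card {0..<int L}"
    proof (rule card_inj_on_le)
      show "inj_on fst Y" by (intro inj_onI diagonal_inj[of _ L]) (auto simp: Y_def)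
    qed (auto simp: Y_def torus_def)
    then show ?thesis by simp
  qed
  have "?D \<subseteq> X \<union> Y"
  proof
    fix y assume "y \<in> ?D"
    define d where "d = (fst y + snd y) mod int L"
    have y: "y \<in> torus L" and
      eq: "(site_index L (left L y) < m) = (site_index L (down L y) < m)" and
      ne: "(site_index L y < m) \<noteq> (site_index L (down L y) < m)"
      using \<open>y \<in> ?D\<close> by (auto simp: initial_sites_def)
    have d: "0 \<le> d" "d < int L" using assms by (simp_all add: d_def)
    have y0: "0 \<le> fst y" "fst y < int L" using y by (auto simp: torus_def)
    show "y \<in> X \<union> Y"
    proof (cases "d = 0")
      case False
      then have d1: "(d - 1) mod int L = d - 1" using d by simp
      have below: "site_index L (down L y) < m \<longleftrightarrow> d - 1 < D \<or> d - 1 = D \<and> fst y < i"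
        using y assms d y0 False
        by (auto simp: site_index_less_iff diagonal_neighbours d1 D_def i_def simp flip: d_def)
          (auto simp: down_def)
      have at: "site_index L y < m \<longleftrightarrow> d < D \<or> d = D \<and> fst y < i"
        using y assms d y0 by (auto simp: site_index_less_iff D_def i_def simp flip: d_def)
      have "d = D \<and> i \<le> fst y \<or> d = D + 1 \<and> fst y < i"
        using ne unfolding below at by linarith
      then show ?thesis using y by (auto simp: Y_def simp flip: d_def)
    qed (use y in \<open>simp add: X_def d_def\<close>)
  qed
  moreover have "finite X" "finite Y" by (simp_all add: X_def Y_def)
  ultimately have "card ?D \<le> card X + card Y"
    by (meson card_Un_le card_mono finite_UnI le_trans)
  with X Y show ?thesis by simp
qed

section \<open>Intermediate configurations and the weight lost along a path\<close>

definition mix :: "site set \<Rightarrow> config \<Rightarrow> config \<Rightarrow> config" where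
  "mix B \<sigma> \<sigma>' x = (if x \<in> B then \<sigma>' x else \<sigma> x)"

text \<open>Supplies the second encoding: products of two spins on the same side of the boundary of
  \<open>B\<close> are kept, those across it change sign.\<close>

definition negate :: "site set \<Rightarrow> config \<Rightarrow> config" where
  "negate B \<sigma> x = (if x \<in> B then - \<sigma> x else \<sigma> x)"

lemma mix_configs [simp]: "\<sigma> \<in> configs L \<Longrightarrow> \<sigma>' \<in> configs L \<Longrightarrow> mix B \<sigma> \<sigma>' \<in> configs L"
  by (auto simp: configs_def mix_def PiE_iff extensional_def)

lemma negate_configs [simp]:
  assumes "\<sigma> \<in> configs L" "B \<subseteq> torus L"
  shows "negate B \<sigma> \<in> configs L"
  using assms(2) config_spin[OF assms(1)] assms(1)
  by (auto simp: configs_def negate_def PiE_iff extensional_def)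

text \<open>Exchanging the parts in \<open>B\<close> is an involution on pairs, so an intermediate
  configuration and the complementary mixture determine the two endpoints.\<close>

lemma mix_mix [simp]: "mix B (mix B \<sigma> \<sigma>') (mix B \<sigma>' \<sigma>) = \<sigma>"
  by (auto simp: mix_def)

lemma negate_negate [simp]: "negate B (negate B \<sigma>) = \<sigma>"
  by (auto simp: negate_def)

lemma cosh_le_exp_mult:
  fixes x y d :: real
  assumes "\<bar>x\<bar> \<le> \<bar>y\<bar> + d" and "0 \<le> d"
  shows "cosh x \<le> exp d * cosh y"
proof -
  have "cosh x \<le> cosh (d + \<bar>y\<bar>)"
    using assms by (subst cosh_real_abs[symmetric], subst cosh_real_nonneg_le_iff) auto
  also have "\<dots> \<le> exp d * cosh \<bar>y\<bar>"
  proof -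
    have "exp (d + \<bar>y\<bar>) = exp d * exp \<bar>y\<bar>" "exp (- d - \<bar>y\<bar>) \<le> exp d * exp (- \<bar>y\<bar>)"
      unfolding exp_add[symmetric] using assms(2) by simp_all
    then show ?thesis by (simp add: cosh_field_def field_simps)
  qed
  finally show ?thesis by simp
qed

context
  fixes J q :: real
  assumes q_nonneg: "0 \<le> q" and q_le_J: "q \<le> J"
begin

text \<open>The reference is the largest weight \<open>cosh (2 * J + q)\<close>: equal neighbour
  spins fall short of it by at most \<open>exp (2 * q)\<close>, opposite ones by at most
  \<open>exp (2 * J)\<close>. Here \<open>q \<le> J\<close> makes the uniform bound
  \<open>exp (2 * J)\<close> cover equal neighbours as well.\<close>

lemma spin_weight_bounds:
  fixes a b s t :: real
  assumes "a = -1 \<or> a = 1" "b = -1 \<or> b = 1" "s = -1 \<or> s = 1" "t = -1 \<or> t = 1"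
  shows "cosh (J * (a + b) + q * s) \<le> exp (2 * q) * cosh (J * (a + b) + q * t)"
    and "cosh (J * (a + b) + q * s) \<le> cosh (2 * J + q)"
    and "cosh (2 * J + q) \<le> exp (2 * J) * cosh (J * (a + b) + q * s)"
    and "a = b \<Longrightarrow> cosh (2 * J + q) \<le> exp (2 * q) * cosh (J * (a + b) + q * s)"
proof -
  show "cosh (J * (a + b) + q * s) \<le> exp (2 * q) * cosh (J * (a + b) + q * t)"
    using assms q_nonneg q_le_J by (intro cosh_le_exp_mult) (elim disjE; simp; arith)+
  have "cosh (J * (a + b) + q * s) \<le> exp 0 * cosh (2 * J + q)"
    using assms q_nonneg q_le_J by (intro cosh_le_exp_mult) (elim disjE; simp; arith)+
  then show "cosh (J * (a + b) + q * s) \<le> cosh (2 * J + q)" by simp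
  show "cosh (2 * J + q) \<le> exp (2 * J) * cosh (J * (a + b) + q * s)"
    using assms q_nonneg q_le_J by (intro cosh_le_exp_mult) (elim disjE; simp; arith)+
  show "cosh (2 * J + q) \<le> exp (2 * q) * cosh (J * (a + b) + q * s)" if "a = b"
    using assms q_nonneg q_le_J that by (intro cosh_le_exp_mult) (elim disjE; simp; arith)+
qed

lemma cosh_neg_spins: "cosh (J * (- a + - b) + q * s) = cosh (J * (a + b) + q * - s)"
proof -
  have "J * (- a + - b) + q * s = - (J * (a + b) + q * - s)" by (simp add: algebra_simps)
  then show ?thesis by (simp only: cosh_minus)
qed

text \<open>Two estimates of the same product, one for each encoding \<open>f\<close> and
  \<open>g\<close>, are multiplied; this is why the site bounds are stated for squares.\<close>

lemma product_square_le:
  fixes u v e f g k m :: real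
  assumes "0 \<le> u" "0 \<le> v" "0 \<le> e" "0 \<le> f" "0 \<le> g" "0 \<le> k" "0 \<le> m"
    and "u * v \<le> k * (e * f)" "u * v \<le> m * (e * g)"
  shows "(u * v)\<^sup>2 \<le> k * m * (e\<^sup>2 * f * g)"
proof -
  have "(u * v) * (u * v) \<le> (k * (e * f)) * (m * (e * g))"
    using assms by (intro mult_mono[OF assms(8,9)]) auto
  then show ?thesis by (simp add: power2_eq_square mult_ac)
qed

text \<open>\<open>l\<close>, \<open>d\<close>, \<open>s\<close> are the spins at the left and down neighbours of a site and at the site itself;
  \<open>A\<close>, \<open>B\<close>, \<open>C\<close> tell which of these three sites lie in the part that has been updated. In the split
  case \<open>A \<noteq> B\<close> exactly one of the last two factors has \<open>l \<noteq> d\<close>, which saves a factor \<open>exp (2 J)\<close>.\<close>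

lemma site_weight_bound:
  fixes l d s l' d' s' :: real and A B C :: bool
  defines "W \<equiv> \<lambda>a b s. cosh (J * (a + b) + q * s)"
  assumes spins: "l = -1 \<or> l = 1" "d = -1 \<or> d = 1" "s = -1 \<or> s = 1"
    "l' = -1 \<or> l' = 1" "d' = -1 \<or> d' = 1" "s' = -1 \<or> s' = 1"
  shows "(W l d s * W l' d' s')\<^sup>2
    \<le> exp (8 * q * of_bool (A = B \<and> C \<noteq> B) + (6 * J + 2 * q) * of_bool (A \<noteq> B)) *
      ((W (if A then l' else l) (if B then d' else d) (if C then s' else s))\<^sup>2 *
        W (if A then l else l') (if B then d else d') (if C then s else s') *
        W (if A then - l else l') (if B then - d else d') (if C then - s else s'))"
proof -
  have pos: "0 < W a b s" for a b s by (simp add: W_def)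
  note nn = less_imp_le[OF pos]
  have minus: "W (- a) (- b) s = W a b (- s)" for a b s
    by (simp only: W_def cosh_neg_spins)
  have change: "W a b s \<le> exp (2 * q) * W a b t"
    if "a = -1 \<or> a = 1" "b = -1 \<or> b = 1" "s = -1 \<or> s = 1" "t = -1 \<or> t = 1" for a b s t
    using spin_weight_bounds(1)[OF that] by (simp add: W_def)
  have change2: "W a b s * W a' b' s' \<le> exp (4 * q) * (W a b t * W a' b' t')"
    if "a = -1 \<or> a = 1" "b = -1 \<or> b = 1" "s = -1 \<or> s = 1" "t = -1 \<or> t = 1"
      "a' = -1 \<or> a' = 1" "b' = -1 \<or> b' = 1" "s' = -1 \<or> s' = 1" "t' = -1 \<or> t' = 1"
    for a b s t a' b' s' t'
  proof -
    have "W a b s * W a' b' s' \<le> (exp (2 * q) * W a b t) * (exp (2 * q) * W a' b' t')"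
      using that by (intro mult_mono change nn) (auto simp: nn)
    also have "\<dots> = exp (4 * q) * (W a b t * W a' b' t')"
      by (simp flip: exp_add add: mult_ac)
    finally show ?thesis .
  qed
  have e8: "exp (4 * q) * exp (4 * q) = exp (8 * q)" by (simp flip: exp_add)
  have neg: "- a = -1 \<or> - a = 1" if "a = -1 \<or> a = 1" for a :: real using that by auto
  have pick: "(if X then a else b) = -1 \<or> (if X then a else b) = 1"
    if "a = -1 \<or> a = 1" "b = -1 \<or> b = 1" for X and a b :: real
    using that by (cases X) simp_all
  define G where "G = cosh (2 * J + q)"
  consider "A = B" "C = B" | "A" "B" "\<not> C" | "\<not> A" "\<not> B" "C" | "A \<noteq> B" by blast
  then show ?thesis
  proof cases
    \<comment> \<open>All three spins come from the same side, so a negation hits all or none of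
      them; as cosh is even, equality holds.\<close>
    case 1
    then show ?thesis
      by (cases B) (simp_all add: minus power2_eq_square mult_ac)
  next
    \<comment> \<open>Only the spin at the site itself is exchanged. This costs
      \<open>exp (2 * q)\<close> for each of two weights, in each of two encodings, hence
      \<open>exp (8 * q)\<close>.\<close>
    case 2
    have "(W l d s * W l' d' s')\<^sup>2 \<le> exp (4 * q) * exp (4 * q) * ((W l' d' s)\<^sup>2 * W l d s' * W l d (- s'))"
    proof (rule product_square_le)
      show "W l d s * W l' d' s' \<le> exp (4 * q) * (W l' d' s * W l d s')"
        using change2[of l d s s' l' d' s' s, OF spins(1-3,6,4-6,3)] by (simp only: mult.commute)
      show "W l d s * W l' d' s' \<le> exp (4 * q) * (W l' d' s * W l d (- s'))"
        using change2[of l d s "- s'" l' d' s' s, OF spins(1-3) neg[OF spins(6)] spins(4-6,3)]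
        by (simp only: mult.commute)
    qed (simp_all add: nn)
    then show ?thesis using 2 by (simp add: minus e8)
  next
    case 3
    have "(W l d s * W l' d' s')\<^sup>2 \<le> exp (4 * q) * exp (4 * q) * ((W l d s')\<^sup>2 * W l' d' s * W l' d' (- s))"
    proof (rule product_square_le)
      show "W l d s * W l' d' s' \<le> exp (4 * q) * (W l d s' * W l' d' s)"
        using change2[of l d s s' l' d' s' s, OF spins(1-3,6,4-6,3)] .
      show "W l d s * W l' d' s' \<le> exp (4 * q) * (W l d s' * W l' d' (- s))"
        using change2[of l d s s' l' d' s' "- s", OF spins(1-3,6,4-6) neg[OF spins(3)]] .
    qed (simp_all add: nn)
    then show ?thesis using 3 by (simp add: e8)
  next
    case 4
    \<comment> \<open>Everything is compared with \<open>G\<close>: the square of \<open>e\<close>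
      costs \<open>exp (4 * J)\<close>, and \<open>f\<close> and \<open>g\<close> together cost only
      \<open>exp (2 * J + 2 * q)\<close>.\<close>
    have G: "0 < G" by (simp add: G_def)
    have le_G: "W a b s \<le> G" and G_le: "G \<le> exp (2 * J) * W a b s"
      and G_le_eq: "a = b \<Longrightarrow> G \<le> exp (2 * q) * W a b s"
      if "a = -1 \<or> a = 1" "b = -1 \<or> b = 1" "s = -1 \<or> s = 1" for a b s
      using spin_weight_bounds[OF that, of 1] by (auto simp: W_def G_def)
    define e where "e = W (if A then l' else l) (if B then d' else d) (if C then s' else s)"
    define f where "f = W (if A then l else l') (if B then d else d') (if C then s else s')"
    define g where "g = W (if A then - l else l') (if B then - d else d') (if C then - s else s')"
    have e: "G \<le> exp (2 * J) * e" unfolding e_def by (intro G_le pick spins)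
    have fg: "G * G \<le> exp (2 * J + 2 * q) * (f * g)"
    proof -
      have f1: "G \<le> exp (2 * J) * f" unfolding f_def by (intro G_le pick spins)
      have g1: "G \<le> exp (2 * J) * g" unfolding g_def by (intro G_le pick spins neg)
      have "(if A then l else l') = (if B then d else d')
          \<or> (if A then - l else l') = (if B then - d else d')"
        using 4 spins(1,2,4,5) by (cases A) auto
      then show ?thesis
      proof
        assume "(if A then l else l') = (if B then d else d')"
        then have "G \<le> exp (2 * q) * f" unfolding f_def by (intro G_le_eq pick spins)
        then have "G * G \<le> (exp (2 * q) * f) * (exp (2 * J) * g)"
          using g1 G by (intro mult_mono) (simp_all add: f_def nn less_imp_le)
        then show ?thesis by (simp only: exp_add mult_ac)
      next
        assume "(if A then - l else l') = (if B then - d else d')"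
        then have "G \<le> exp (2 * q) * g" unfolding g_def by (intro G_le_eq pick spins neg)
        with f1 have "G * G \<le> (exp (2 * J) * f) * (exp (2 * q) * g)"
          using G by (intro mult_mono) (simp_all add: f_def nn less_imp_le)
        then show ?thesis by (simp only: exp_add mult_ac)
      qed
    qed
    have "(W l d s * W l' d' s')\<^sup>2 \<le> (G * G)\<^sup>2"
      using G by (intro power_mono mult_mono le_G spins) (simp_all add: nn less_imp_le)
    also have "\<dots> = (G * G) * (G * G)" by (simp add: power2_eq_square)
    also have "\<dots> \<le> ((exp (2 * J) * e) * (exp (2 * J) * e)) * (exp (2 * J + 2 * q) * (f * g))"
      using G by (intro mult_mono[OF mult_mono[OF e e] fg]) (simp_all add: e_def nn less_imp_le)
    also have "\<dots> = exp (2 * J + 2 * J + (2 * J + 2 * q)) * (e\<^sup>2 * f * g)"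
      by (simp only: exp_add power2_eq_square mult_ac)
    finally show ?thesis using 4 by (simp add: e_def f_def g_def algebra_simps)
  qed
qed

end

text \<open>The site bounds are multiplied over the torus and a square root is taken. The geometric
  mean of the weights of the two encodings is then replaced by their arithmetic mean, which can be
  summed over configurations.\<close>

lemma Z_interpolation:
  fixes J q :: real and L m :: nat
  assumes "0 < L" "0 \<le> q" "q \<le> J" and \<sigma>: "\<sigma> \<in> configs L" and \<sigma>': "\<sigma>' \<in> configs L"
  defines "B \<equiv> initial_sites L m"
  shows "Z L J q \<sigma> * Z L J q \<sigma>' \<le> exp (8 * q * L + 6 * J + 2 * q) * (Z L J q (mix B \<sigma> \<sigma>') *
    ((Z L J q (mix B \<sigma>' \<sigma>) + Z L J q (negate B (mix B \<sigma>' \<sigma>))) / 2))"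
proof -
  define z1 where "z1 = Z L J q (mix B \<sigma> \<sigma>')"
  define z2 where "z2 = Z L J q (mix B \<sigma>' \<sigma>)"
  define z3 where "z3 = Z L J q (negate B (mix B \<sigma>' \<sigma>))"
  define D where "D = {y \<in> torus L. (left L y \<in> B) = (down L y \<in> B) \<and> (y \<in> B) \<noteq> (down L y \<in> B)}"
  define C where "C = {y \<in> torus L. (left L y \<in> B) \<noteq> (down L y \<in> B)}"
  define \<kappa> where "\<kappa> y = 8 * q * of_bool ((left L y \<in> B) = (down L y \<in> B) \<and> (y \<in> B) \<noteq> (down L y \<in> B))
      + (6 * J + 2 * q) * of_bool ((left L y \<in> B) \<noteq> (down L y \<in> B))" for y
  define h where "h \<eta> y = cosh (field_in L J q \<eta> y)" for \<eta> y
  have site: "(h \<sigma> y * h \<sigma>' y)\<^sup>2 \<le> exp (\<kappa> y) *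
      ((h (mix B \<sigma> \<sigma>') y)\<^sup>2 * h (mix B \<sigma>' \<sigma>) y * h (negate B (mix B \<sigma>' \<sigma>)) y)"
    if "y \<in> torus L" for y
    using site_weight_bound[OF assms(2,3), of "\<sigma> (left L y)" "\<sigma> (down L y)" "\<sigma> y"
        "\<sigma>' (left L y)" "\<sigma>' (down L y)" "\<sigma>' y" "left L y \<in> B" "down L y \<in> B" "y \<in> B"]
      that config_spin[OF \<sigma>] config_spin[OF \<sigma>']
    unfolding \<kappa>_def h_def field_in_def mix_def negate_def
    by (simp add: add.commute cong: if_cong)
  \<comment> \<open>At most \<open>2 * L\<close> boundary sites and 2 split sites contribute; the
    square root will remove the factor 2.\<close>
  have k: "(\<Sum>y\<in>torus L. \<kappa> y) \<le> 2 * (8 * q * L + 6 * J + 2 * q)"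
  proof -
    have "(\<Sum>y\<in>torus L. \<kappa> y) = 8 * q * card D + (6 * J + 2 * q) * card C"
      by (simp add: \<kappa>_def D_def C_def sum.distrib Int_def flip: sum_distrib_left)
    also have "\<dots> \<le> 8 * q * real (2 * L) + (6 * J + 2 * q) * real 2"
      using card_boundary_sites[OF assms(1), of m] card_split_sites[OF assms(1), of m] assms(2,3)
      by (intro add_mono mult_left_mono of_nat_mono) (auto simp: D_def C_def B_def)
    finally show ?thesis by simp
  qed
  define N where "N = (\<Prod>y\<in>torus L. 2 :: real)"
  have Zh: "Z L J q \<eta> = N * (\<Prod>y\<in>torus L. h \<eta> y)" for \<eta>
    by (simp add: Z_eq_prod prod.distrib N_def h_def)
  have N: "0 < N" by (simp add: N_def)
  have "(\<Prod>y\<in>torus L. (h \<sigma> y * h \<sigma>' y)\<^sup>2) \<le> (\<Prod>y\<in>torus L. exp (\<kappa> y) *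
      ((h (mix B \<sigma> \<sigma>') y)\<^sup>2 * h (mix B \<sigma>' \<sigma>) y * h (negate B (mix B \<sigma>' \<sigma>)) y))"
    by (intro prod_mono conjI site zero_le_power2)
  then have "N ^ 4 * (\<Prod>y\<in>torus L. (h \<sigma> y * h \<sigma>' y)\<^sup>2) \<le> N ^ 4 * (\<Prod>y\<in>torus L. exp (\<kappa> y) *
      ((h (mix B \<sigma> \<sigma>') y)\<^sup>2 * h (mix B \<sigma>' \<sigma>) y * h (negate B (mix B \<sigma>' \<sigma>)) y))"
    using N by (intro mult_left_mono) auto
  then have "(Z L J q \<sigma> * Z L J q \<sigma>')\<^sup>2 \<le> exp (\<Sum>y\<in>torus L. \<kappa> y) * (z1\<^sup>2 * z2 * z3)"
    by (simp add: z1_def z2_def z3_def Zh prod.distrib exp_sum power_mult_distrib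
      prod_power_distrib power2_eq_square power4_eq_xxxx mult_ac)
  also have "\<dots> \<le> exp (2 * (8 * q * L + 6 * J + 2 * q)) * (z1\<^sup>2 * ((z2 + z3) / 2)\<^sup>2)"
  proof -
    have "z2 * z3 \<le> ((z2 + z3) / 2)\<^sup>2"
      using zero_le_power2[of "z2 - z3"] by (simp add: power2_eq_square field_simps)
    then have "z1\<^sup>2 * (z2 * z3) \<le> z1\<^sup>2 * ((z2 + z3) / 2)\<^sup>2" by (intro mult_left_mono) auto
    moreover have "0 \<le> z1\<^sup>2 * (z2 * z3)" by (simp add: z2_def z3_def less_imp_le)
    moreover have "exp (\<Sum>y\<in>torus L. \<kappa> y) \<le> exp (2 * (8 * q * L + 6 * J + 2 * q))" using k by simp
    ultimately show ?thesis
      unfolding mult.assoc[of _ z2] by (intro mult_mono[of "exp _" "exp _"]) simp_all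
  qed
  also have "\<dots> = (exp (8 * q * L + 6 * J + 2 * q) * (z1 * ((z2 + z3) / 2)))\<^sup>2"
    unfolding exp_double power_mult_distrib by simp
  finally show ?thesis
    unfolding z1_def z2_def z3_def by (rule power2_le_imp_le) (simp add: less_imp_le add_nonneg_nonneg)
qed

section \<open>The Poincare inequality\<close>

text \<open>The change of variables by which pairs of endpoints are counted through their
  encodings.\<close>

lemma sum_swap_parts:
  fixes F :: "config \<Rightarrow> config \<Rightarrow> real"
  shows "(\<Sum>\<sigma>\<in>configs L. \<Sum>\<sigma>'\<in>configs L. F (mix B \<sigma> \<sigma>') (mix B \<sigma>' \<sigma>))
    = (\<Sum>\<eta>\<in>configs L. \<Sum>\<zeta>\<in>configs L. F \<eta> \<zeta>)"
proof -
  have "(\<Sum>(\<sigma>, \<sigma>')\<in>configs L \<times> configs L. F (mix B \<sigma> \<sigma>') (mix B \<sigma>' \<sigma>))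
    = (\<Sum>(\<eta>, \<zeta>)\<in>configs L \<times> configs L. F \<eta> \<zeta>)"
    by (rule sum.reindex_bij_witness[of _ "\<lambda>(\<eta>, \<zeta>). (mix B \<eta> \<zeta>, mix B \<zeta> \<eta>)"
          "\<lambda>(\<eta>, \<zeta>). (mix B \<eta> \<zeta>, mix B \<zeta> \<eta>)"]) auto
  then show ?thesis by (simp add: sum.cartesian_product)
qed

lemma sum_negate:
  assumes "B \<subseteq> torus L"
  shows "(\<Sum>\<zeta>\<in>configs L. F (negate B \<zeta>)) = (\<Sum>\<zeta>\<in>configs L. F \<zeta>)"
  using assms by (intro sum_involution) simp_all

context
  fixes L :: nat and J q :: real
  assumes L_ge: "2 \<le> L" and q_nonneg: "0 \<le> q" and q_le_J: "q \<le> J"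
begin

text \<open>The right-hand side of \<open>poincare\<close> for this chain. By stationarity it is the
  Dirichlet form of the reversible kernel obtained by composing \<open>P\<close> with its adjoint
  with respect to \<open>pi_PCA\<close>.\<close>

definition dirichlet :: "(config \<Rightarrow> real) \<Rightarrow> real" where
  "dirichlet f = (\<Sum>\<sigma>\<in>configs L. pi_PCA L J q \<sigma> *
    (kernel_op (configs L) (P L J q) (\<lambda>\<tau>. (f \<tau>)\<^sup>2) \<sigma> - (kernel_op (configs L) (P L J q) f \<sigma>)\<^sup>2))"

definition wall :: "site \<Rightarrow> config \<Rightarrow> bool" where
  "wall x \<eta> \<longleftrightarrow> \<eta> x \<noteq> \<eta> (up L (left L x))"

text \<open>For \<open>L \<ge> 2\<close> the two compared sites differ, so a flip at
  \<open>x\<close> changes just one of the two spins. Hence exactly one end of every flip has a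
  wall, and the flip can be charged to that end.\<close>

lemma wall_flip:
  assumes "x \<in> torus L" and "\<eta> \<in> configs L"
  shows "wall x (flip x \<eta>) \<longleftrightarrow> \<not> wall x \<eta>"
proof -
  have "fst x = (fst x - 1) mod int L \<Longrightarrow> False"
  proof -
    assume *: "fst x = (fst x - 1) mod int L"
    then have "fst x mod int L = (fst x - 1) mod int L" by (metis mod_mod_trivial)
    then have "int L dvd 1" by (simp add: mod_eq_dvd_iff)
    then show False using L_ge by simp
  qed
  then have "up L (left L x) \<noteq> x"
    by (auto simp: up_def left_def prod_eq_iff)
  moreover have "\<eta> x = -1 \<or> \<eta> x = 1" "\<eta> (up L (left L x)) = -1 \<or> \<eta> (up L (left L x)) = 1"
    using assms by (simp_all add: config_spin)
  ultimately show ?thesis by (auto simp: wall_def flip_def)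
qed

text \<open>\<open>flip_rate_ge\<close> bounds the weight of a wall configuration by the mean rate
  of its flip. For each \<sigma>, the rates are summed by the law of total variance for
  \<open>P L J q \<sigma>\<close> with the involution \<open>flip x\<close>.\<close>

lemma wall_energy_le_dirichlet:
  assumes x: "x \<in> torus L"
  shows "(\<Sum>\<eta>\<in>configs L. of_bool (wall x \<eta>) * pi_PCA L J q \<eta> * (f \<eta> - f (flip x \<eta>))\<^sup>2)
    \<le> 2 * (1 + exp (2 * q))\<^sup>2 * dirichlet f"
proof -
  define r where "r \<sigma> \<eta> = P L J q \<sigma> \<eta> * P L J q \<sigma> (flip x \<eta>) / (P L J q \<sigma> \<eta> + P L J q \<sigma> (flip x \<eta>))"
    for \<sigma> \<eta>
  define K where "K = (1 + exp (2 * q))\<^sup>2"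
  have K: "0 < K" unfolding K_def by (intro zero_less_power add_pos_pos) auto
  have r: "0 \<le> r \<sigma> \<eta>" for \<sigma> \<eta> by (simp add: r_def less_imp_le)
  have "of_bool (wall x \<eta>) * pi_PCA L J q \<eta> \<le> K * (\<Sum>\<sigma>\<in>configs L. pi_PCA L J q \<sigma> * r \<sigma> \<eta>)"
    if "\<eta> \<in> configs L" for \<eta>
  proof (cases "wall x \<eta>")
    case True
    have "pi_PCA L J q \<eta> / K \<le> (\<Sum>\<sigma>\<in>configs L. pi_PCA L J q \<sigma> * r \<sigma> \<eta>)"
      unfolding K_def r_def using True q_nonneg q_le_J x that
      by (intro flip_rate_ge) (auto simp: wall_def)
    then show ?thesis using True K by (simp add: field_simps)
  qed (use K r in \<open>auto intro!: mult_nonneg_nonneg sum_nonneg simp: less_imp_le\<close>)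
  then have "(\<Sum>\<eta>\<in>configs L. of_bool (wall x \<eta>) * pi_PCA L J q \<eta> * (f \<eta> - f (flip x \<eta>))\<^sup>2)
    \<le> (\<Sum>\<eta>\<in>configs L. K * (\<Sum>\<sigma>\<in>configs L. pi_PCA L J q \<sigma> * r \<sigma> \<eta>) * (f \<eta> - f (flip x \<eta>))\<^sup>2)"
    by (intro sum_mono mult_right_mono) auto
  also have "\<dots> = (\<Sum>\<eta>\<in>configs L. \<Sum>\<sigma>\<in>configs L.
      K * pi_PCA L J q \<sigma> * (r \<sigma> \<eta> * (f \<eta> - f (flip x \<eta>))\<^sup>2))"
    by (simp add: sum_distrib_left sum_distrib_right mult_ac)
  also have "\<dots> = (\<Sum>\<sigma>\<in>configs L. K * pi_PCA L J q \<sigma> *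
      (\<Sum>\<eta>\<in>configs L. r \<sigma> \<eta> * (f \<eta> - f (flip x \<eta>))\<^sup>2))"
    by (subst sum.swap) (simp add: sum_distrib_left)
  also have "\<dots> \<le> (\<Sum>\<sigma>\<in>configs L. K * pi_PCA L J q \<sigma> *
      (2 * (kernel_op (configs L) (P L J q) (\<lambda>\<tau>. (f \<tau>)\<^sup>2) \<sigma> - (kernel_op (configs L) (P L J q) f \<sigma>)\<^sup>2)))"
  proof (intro sum_mono mult_left_mono)
    fix \<sigma>
    have "(\<Sum>\<eta>\<in>configs L. r \<sigma> \<eta> * (f \<eta> - f (flip x \<eta>))\<^sup>2) / 2
      \<le> (\<Sum>\<eta>\<in>configs L. P L J q \<sigma> \<eta> * (f \<eta>)\<^sup>2) - (\<Sum>\<eta>\<in>configs L. P L J q \<sigma> \<eta> * f \<eta>)\<^sup>2"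
      unfolding r_def using x by (intro variance_ge_orbit_variance) (auto simp: sum_P)
    then show "(\<Sum>\<eta>\<in>configs L. r \<sigma> \<eta> * (f \<eta> - f (flip x \<eta>))\<^sup>2)
      \<le> 2 * (kernel_op (configs L) (P L J q) (\<lambda>\<tau>. (f \<tau>)\<^sup>2) \<sigma> - (kernel_op (configs L) (P L J q) f \<sigma>)\<^sup>2)"
      by (simp add: kernel_op_def)
  qed (use K in \<open>simp add: less_imp_le\<close>)
  also have "\<dots> = 2 * K * dirichlet f"
    by (simp add: dirichlet_def sum_distrib_left mult_ac)
  finally show ?thesis by (simp add: K_def)
qed

text \<open>The congestion bound: after passing to the encoding (\<eta>, \<zeta>), the sum over
  \<zeta> is 1 because both encodings have total mass 1. As \<open>x\<close> and \<open>m\<close>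
  are independent, it serves a step seen from either of its ends.\<close>

lemma path_step_energy:
  assumes x: "x \<in> torus L" and B: "B = initial_sites L m"
  shows "(\<Sum>\<sigma>\<in>configs L. \<Sum>\<sigma>'\<in>configs L. pi_PCA L J q \<sigma> * pi_PCA L J q \<sigma>' *
      (of_bool (wall x (mix B \<sigma> \<sigma>')) * (f (mix B \<sigma> \<sigma>') - f (flip x (mix B \<sigma> \<sigma>')))\<^sup>2))
    \<le> exp (8 * q * L + 6 * J + 2 * q) * (2 * (1 + exp (2 * q))\<^sup>2 * dirichlet f)"
    (is "?lhs \<le> ?C * _")
proof -
  define g where "g \<eta> = of_bool (wall x \<eta>) * (f \<eta> - f (flip x \<eta>))\<^sup>2" for \<eta>
  have g: "0 \<le> g \<eta>" for \<eta> by (simp add: g_def)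
  define p where "p = pi_PCA L J q"
  define W where "W = (\<Sum>\<sigma>\<in>configs L. Z L J q \<sigma>)"
  have W: "0 < W" by (simp add: W_def)
  have p: "p \<sigma> = Z L J q \<sigma> / W" for \<sigma> by (simp add: p_def pi_PCA_def W_def)
  have BT: "B \<subseteq> torus L" by (auto simp: B initial_sites_def)
  have bound: "p \<sigma> * p \<sigma>' \<le> ?C * (p (mix B \<sigma> \<sigma>') * ((p (mix B \<sigma>' \<sigma>) + p (negate B (mix B \<sigma>' \<sigma>))) / 2))"
    if "\<sigma> \<in> configs L" "\<sigma>' \<in> configs L" for \<sigma> \<sigma>'
  proof -
    have "Z L J q \<sigma> * Z L J q \<sigma>' / (W * W) \<le> ?C * (Z L J q (mix B \<sigma> \<sigma>') *
      ((Z L J q (mix B \<sigma>' \<sigma>) + Z L J q (negate B (mix B \<sigma>' \<sigma>))) / 2)) / (W * W)"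
      using L_ge q_nonneg q_le_J that W unfolding B by (intro divide_right_mono Z_interpolation) auto
    also have "\<dots> = ?C * (p (mix B \<sigma> \<sigma>') * ((p (mix B \<sigma>' \<sigma>) + p (negate B (mix B \<sigma>' \<sigma>))) / 2))"
      unfolding p by (simp add: add_divide_distrib[symmetric])
    finally show ?thesis by (simp add: p)
  qed
  have swap: "u * (v * w) * z = u * (v * z) * w" for u v w z :: real by simp
  have "?lhs = (\<Sum>\<sigma>\<in>configs L. \<Sum>\<sigma>'\<in>configs L. p \<sigma> * p \<sigma>' * g (mix B \<sigma> \<sigma>'))"
    by (simp add: p_def g_def)
  also have "\<dots> \<le> (\<Sum>\<sigma>\<in>configs L. \<Sum>\<sigma>'\<in>configs L.
      ?C * (p (mix B \<sigma> \<sigma>') * ((p (mix B \<sigma>' \<sigma>) + p (negate B (mix B \<sigma>' \<sigma>))) / 2)) * g (mix B \<sigma> \<sigma>'))"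
    by (intro sum_mono mult_right_mono bound g)
  also have "\<dots> = (\<Sum>\<eta>\<in>configs L. \<Sum>\<zeta>\<in>configs L.
      ?C * (p \<eta> * ((p \<zeta> + p (negate B \<zeta>)) / 2)) * g \<eta>)"
    by (rule sum_swap_parts)
  also have "\<dots> = (\<Sum>\<eta>\<in>configs L. ?C * (p \<eta> * g \<eta>) * (\<Sum>\<zeta>\<in>configs L. (p \<zeta> + p (negate B \<zeta>)) / 2))"
    unfolding sum_distrib_left by (intro sum.cong refl swap)
  also have "(\<Sum>\<zeta>\<in>configs L. (p \<zeta> + p (negate B \<zeta>)) / 2) = 1"
    using sum_negate[OF BT, of p] sum_pi_PCA[of L J q]
    by (simp add: sum.distrib p_def flip: sum_divide_distrib)
  also have "(\<Sum>\<eta>\<in>configs L. ?C * (p \<eta> * g \<eta>) * 1)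
    = ?C * (\<Sum>\<eta>\<in>configs L. of_bool (wall x \<eta>) * p \<eta> * (f \<eta> - f (flip x \<eta>))\<^sup>2)"
    unfolding sum_distrib_left by (intro sum.cong refl) (simp add: g_def)
  also have "\<dots> \<le> ?C * (2 * (1 + exp (2 * q))\<^sup>2 * dirichlet f)"
    using wall_energy_le_dirichlet[OF x, of f] unfolding p_def by (intro mult_left_mono) auto
  finally show ?thesis .
qed

text \<open>Any two configurations are joined by a path of \<open>N\<close> steps, the square of
  \<open>L\<close>. One factor \<open>N\<close> comes from Cauchy-Schwarz along the path and another
  from adding the energies of the \<open>N\<close> steps.\<close>

lemma variance_le_dirichlet:
  "variance_on (configs L) (pi_PCA L J q) f
    \<le> 2 * real L ^ 4 * exp (8 * q * L + 6 * J + 2 * q) * (1 + exp (2 * q))\<^sup>2 * dirichlet f"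
proof -
  define N where "N = L\<^sup>2"
  define p where "p = pi_PCA L J q"
  define E where "E = exp (8 * q * L + 6 * J + 2 * q) * (2 * (1 + exp (2 * q))\<^sup>2 * dirichlet f)"
  define \<eta> where "\<eta> m \<sigma> \<sigma>' = mix (initial_sites L m) \<sigma> \<sigma>'" for m \<sigma> \<sigma>'
  have L: "0 < L" using L_ge by simp
  define site where "site = the_inv_into (torus L) (site_index L)"
  have bij: "bij_betw (site_index L) (torus L) {..<N}"
    unfolding N_def by (rule bij_betw_site_index[OF L])
  have site: "site n \<in> torus L" "site_index L (site n) = n" if "n < N" for n
    using that bij the_inv_into_into[of "site_index L" "torus L" n "torus L"]
      f_the_inv_into_f[of "site_index L" "torus L" n]
    by (auto simp: site_def bij_betw_def)
  have p: "0 < p \<sigma>" for \<sigma> by (simp add: p_def)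
  have ends: "\<eta> 0 \<sigma> \<sigma>' = \<sigma>" "\<eta> N \<sigma> \<sigma>' = \<sigma>'" if "\<sigma> \<in> configs L" "\<sigma>' \<in> configs L" for \<sigma> \<sigma>'
  proof -
    have "initial_sites L N = torus L"
      using bij by (auto simp: initial_sites_def bij_betw_def)
    moreover have "\<sigma> x = \<sigma>' x" if "x \<notin> torus L" for x
      using that \<open>\<sigma> \<in> configs L\<close> \<open>\<sigma>' \<in> configs L\<close> PiE_arb unfolding configs_def by metis
    ultimately show "\<eta> N \<sigma> \<sigma>' = \<sigma>'" by (auto simp: \<eta>_def mix_def)
  qed (auto simp: \<eta>_def mix_def initial_sites_def)
  have step: "\<eta> (Suc n) \<sigma> \<sigma>' = \<eta> n \<sigma> \<sigma>' \<or> \<eta> (Suc n) \<sigma> \<sigma>' = flip (site n) (\<eta> n \<sigma> \<sigma>')"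
    if "n < N" "\<sigma> \<in> configs L" "\<sigma>' \<in> configs L" for n \<sigma> \<sigma>'
  proof -
    have x: "site n \<in> torus L" "site n \<notin> initial_sites L n"
      using site[OF \<open>n < N\<close>] by (auto simp: initial_sites_def)
    have "initial_sites L (Suc n) = insert (site n) (initial_sites L n)"
      using site[OF \<open>n < N\<close>] bij by (auto simp: initial_sites_def bij_betw_def less_Suc_eq inj_on_def)
    then have "\<eta> (Suc n) \<sigma> \<sigma>' = (\<eta> n \<sigma> \<sigma>')(site n := \<sigma>' (site n))"
      by (auto simp: \<eta>_def mix_def)
    moreover have "\<eta> n \<sigma> \<sigma>' (site n) = \<sigma> (site n)" using x by (simp add: \<eta>_def mix_def)
    moreover have "\<sigma>' (site n) = \<sigma> (site n) \<or> \<sigma>' (site n) = - \<sigma> (site n)"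
      using config_spin[OF that(2) x(1)] config_spin[OF that(3) x(1)] by auto
    ultimately show ?thesis by (auto simp: flip_def)
  qed
  \<comment> \<open>The jump at the \<open>n\<close>-th site seen from position \<open>m\<close> of
    the path, counted only if there is a wall there; \<open>m\<close> will be \<open>n\<close> or
    \<open>Suc n\<close>.\<close>
  define D where "D m n \<sigma> \<sigma>' = of_bool (wall (site n) (\<eta> m \<sigma> \<sigma>')) *
    (f (\<eta> m \<sigma> \<sigma>') - f (flip (site n) (\<eta> m \<sigma> \<sigma>')))\<^sup>2" for m n \<sigma> \<sigma>'
  have D: "0 \<le> D m n \<sigma> \<sigma>'" for m n \<sigma> \<sigma>' by (simp add: D_def)
  have jump: "(f (\<eta> (Suc n) \<sigma> \<sigma>') - f (\<eta> n \<sigma> \<sigma>'))\<^sup>2 \<le> D n n \<sigma> \<sigma>' + D (Suc n) n \<sigma> \<sigma>'"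
    if "n < N" "\<sigma> \<in> configs L" "\<sigma>' \<in> configs L" for n \<sigma> \<sigma>'
    using step[OF that]
  proof
    assume "\<eta> (Suc n) \<sigma> \<sigma>' = \<eta> n \<sigma> \<sigma>'"
    then show ?thesis using D by simp
  next
    assume *: "\<eta> (Suc n) \<sigma> \<sigma>' = flip (site n) (\<eta> n \<sigma> \<sigma>')"
    have "wall (site n) (\<eta> (Suc n) \<sigma> \<sigma>') \<longleftrightarrow> \<not> wall (site n) (\<eta> n \<sigma> \<sigma>')"
      unfolding * using that site by (intro wall_flip) (auto simp: \<eta>_def)
    then show ?thesis
      by (cases "wall (site n) (\<eta> n \<sigma> \<sigma>')") (simp_all add: D_def * power2_commute)
  qed
  have energy: "(\<Sum>\<sigma>\<in>configs L. \<Sum>\<sigma>'\<in>configs L. p \<sigma> * p \<sigma>' * D m n \<sigma> \<sigma>') \<le> E" if "n < N" for m n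
    unfolding D_def \<eta>_def p_def E_def using site(1)[OF that] by (intro path_step_energy) auto
  have telescope: "(f \<sigma>' - f \<sigma>)\<^sup>2 \<le> N * (\<Sum>n<N. D n n \<sigma> \<sigma>' + D (Suc n) n \<sigma> \<sigma>')"
    if "\<sigma> \<in> configs L" "\<sigma>' \<in> configs L" for \<sigma> \<sigma>'
  proof -
    have "(f \<sigma>' - f \<sigma>)\<^sup>2 = (\<Sum>n<N. f (\<eta> (Suc n) \<sigma> \<sigma>') - f (\<eta> n \<sigma> \<sigma>'))\<^sup>2"
      using sum_lessThan_telescope[of "\<lambda>n. f (\<eta> n \<sigma> \<sigma>')" N] ends[OF that] by simp
    also have "\<dots> \<le> (\<Sum>n<N. (f (\<eta> (Suc n) \<sigma> \<sigma>') - f (\<eta> n \<sigma> \<sigma>'))\<^sup>2) * card {..<N}"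
      by (rule sum_squared_le_sum_of_squares)
    also have "\<dots> \<le> (\<Sum>n<N. D n n \<sigma> \<sigma>' + D (Suc n) n \<sigma> \<sigma>') * card {..<N}"
      using that by (intro mult_right_mono sum_mono jump) auto
    finally show ?thesis by (simp add: mult.commute)
  qed
  have "2 * variance_on (configs L) p f = (\<Sum>\<sigma>\<in>configs L. \<Sum>\<sigma>'\<in>configs L. p \<sigma> * p \<sigma>' * (f \<sigma>' - f \<sigma>)\<^sup>2)"
    using variance_on_eq_pairs[of p "configs L" f] sum_pi_PCA by (simp add: p_def)
  also have "\<dots> \<le> (\<Sum>\<sigma>\<in>configs L. \<Sum>\<sigma>'\<in>configs L. p \<sigma> * p \<sigma>' *
      (N * (\<Sum>n<N. D n n \<sigma> \<sigma>' + D (Suc n) n \<sigma> \<sigma>')))"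
    using p by (intro sum_mono mult_left_mono telescope) (auto simp: less_imp_le)
  also have "\<dots> = (\<Sum>\<sigma>\<in>configs L. \<Sum>\<sigma>'\<in>configs L. \<Sum>n<N.
      N * (p \<sigma> * p \<sigma>' * D n n \<sigma> \<sigma>' + p \<sigma> * p \<sigma>' * D (Suc n) n \<sigma> \<sigma>'))"
    by (simp add: sum_distrib_left algebra_simps)
  also have "\<dots> = (\<Sum>n<N. \<Sum>\<sigma>\<in>configs L. \<Sum>\<sigma>'\<in>configs L.
      N * (p \<sigma> * p \<sigma>' * D n n \<sigma> \<sigma>' + p \<sigma> * p \<sigma>' * D (Suc n) n \<sigma> \<sigma>'))"
    by (simp only: sum.swap[of _ "{..<N}" "configs L"])
  also have "\<dots> = (\<Sum>n<N. N * ((\<Sum>\<sigma>\<in>configs L. \<Sum>\<sigma>'\<in>configs L. p \<sigma> * p \<sigma>' * D n n \<sigma> \<sigma>')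
      + (\<Sum>\<sigma>\<in>configs L. \<Sum>\<sigma>'\<in>configs L. p \<sigma> * p \<sigma>' * D (Suc n) n \<sigma> \<sigma>')))"
    by (simp only: sum_distrib_left sum.distrib distrib_left)
  also have "\<dots> \<le> (\<Sum>n<N. N * (E + E))"
    by (intro sum_mono mult_left_mono add_mono energy) auto
  also have "\<dots> = 2 * (real N * real N * E)" by simp
  finally show ?thesis
    by (simp add: E_def N_def p_def power2_eq_square power4_eq_xxxx mult_ac)
qed

end

section \<open>Mixing\<close>

text \<open>Each cosh lies between 1 and \<open>exp (2 * J + q)\<close>, which bounds the ratio of
  any two values of \<open>Z\<close>. The number of configurations is at most
  \<open>exp (L\<^sup>2)\<close>, which accounts for the summand 1.\<close>

lemma pi_PCA_ge:
  assumes "0 \<le> q" "0 \<le> J" and \<sigma>: "\<sigma> \<in> configs L"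
  shows "exp (- (real (L\<^sup>2) * (2 * J + q + 1))) \<le> pi_PCA L J q \<sigma>"
proof -
  define N where "N = L\<^sup>2"
  have lower: "2 ^ N \<le> Z L J q \<sigma>"
  proof -
    have "(\<Prod>x\<in>torus L. 2 * 1) \<le> (\<Prod>x\<in>torus L. 2 * cosh (field_in L J q \<sigma> x))"
      by (intro prod_mono) (auto intro: cosh_real_ge_1)
    then show ?thesis by (simp add: Z_eq_prod card_torus N_def)
  qed
  have upper: "Z L J q \<tau> \<le> 2 ^ N * exp (N * (2 * J + q))" if "\<tau> \<in> configs L" for \<tau>
  proof -
    have "cosh (field_in L J q \<tau> x) \<le> exp (2 * J + q)" if "x \<in> torus L" for x
    proof -
      have "cosh (field_in L J q \<tau> x) \<le> exp (2 * J + q) * cosh 0"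
        using config_spin[OF \<open>\<tau> \<in> configs L\<close>, of x] config_spin[OF \<open>\<tau> \<in> configs L\<close>, of "left L x"]
          config_spin[OF \<open>\<tau> \<in> configs L\<close>, of "down L x"] that assms(1,2)
        by (intro cosh_le_exp_mult) (auto simp: field_in_def abs_if)
      then show ?thesis by simp
    qed
    then have "(\<Prod>x\<in>torus L. 2 * cosh (field_in L J q \<tau> x)) \<le> (\<Prod>x\<in>torus L. 2 * exp (2 * J + q))"
      by (intro prod_mono) auto
    then show ?thesis
      by (simp add: Z_eq_prod card_torus power_mult_distrib exp_of_nat_mult flip: N_def)
  qed
  have "(\<Sum>\<tau>\<in>configs L. Z L J q \<tau>) \<le> 2 ^ N * (2 ^ N * exp (N * (2 * J + q)))"
    using sum_bounded_above[of "configs L" "Z L J q", OF upper] by (simp add: card_configs N_def)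
  also have "\<dots> \<le> exp (real N) * (Z L J q \<sigma> * exp (N * (2 * J + q)))"
  proof (intro mult_mono lower order_refl)
    have "(2::real) ^ N \<le> exp 1 ^ N" using exp_ge_add_one_self[of "1::real"] by (intro power_mono) auto
    then show "(2::real) ^ N \<le> exp (real N)" by (simp flip: exp_of_nat_mult)
  qed (auto simp: less_imp_le)
  also have "\<dots> = Z L J q \<sigma> * exp (N * (2 * J + q + 1))"
    by (simp add: exp_add[symmetric] algebra_simps)
  finally have "(\<Sum>\<tau>\<in>configs L. Z L J q \<tau>) / exp (N * (2 * J + q + 1)) \<le> Z L J q \<sigma>"
    by (simp add: divide_le_eq)
  then have "exp (- (N * (2 * J + q + 1))) * (\<Sum>\<tau>\<in>configs L. Z L J q \<tau>) \<le> Z L J q \<sigma>"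
    by (simp only: exp_minus divide_inverse mult.commute)
  then show ?thesis
    unfolding pi_PCA_def pos_le_divide_eq[OF sum_Z_pos] N_def .
qed

text \<open>\<open>R\<close> bounds the relaxation time. The squared deviation of an event is at
  most the decay \<open>exp (- t / R)\<close> divided by the minimal stationary weight; the square
  root halves the exponent.\<close>

lemma d_PCA_bounds:
  fixes J q :: real and L t :: nat
  assumes "2 \<le> L" "0 \<le> q" "q \<le> J"
  defines "R \<equiv> 2 * real L ^ 4 * exp (8 * q * L + 6 * J + 2 * q) * (1 + exp (2 * q))\<^sup>2"
  shows "0 \<le> d_PCA L J q t"
    and "d_PCA L J q t \<le> exp ((real (L\<^sup>2) * (2 * J + q + 1) - 1 / R * t) / 2)"
proof -
  define l where "l = 1 / R"
  define b where "b = exp ((real (L\<^sup>2) * (2 * J + q + 1) - 1 / R * t) / 2)"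
  have R: "1 \<le> R"
  proof -
    have "1 \<le> 2 * real L ^ 4" using one_le_power[of "real L" 4] assms(1) by linarith
    moreover have "1 \<le> exp (8 * q * L + 6 * J + 2 * q)" using assms by simp
    moreover have "1 \<le> (1 + exp (2 * q))\<^sup>2" by (intro one_le_power) simp
    ultimately show ?thesis
      using mult_mono[of 1 "2 * real L ^ 4" 1 "exp (8 * q * L + 6 * J + 2 * q)"]
        mult_mono[of 1 "2 * real L ^ 4 * exp (8 * q * L + 6 * J + 2 * q)" 1 "(1 + exp (2 * q))\<^sup>2"]
      unfolding R_def by simp
  qed
  have l: "0 \<le> l" "l \<le> 1"
    using R by (simp_all add: l_def)
  interpret poincare_chain "configs L" "P L J q" "pi_PCA L J q" l
  proof
    fix f
    show "l * variance_on (configs L) (pi_PCA L J q) f \<le> (\<Sum>\<sigma>\<in>configs L. pi_PCA L J q \<sigma> *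
      (kernel_op (configs L) (P L J q) (\<lambda>\<tau>. (f \<tau>)\<^sup>2) \<sigma> - (kernel_op (configs L) (P L J q) f \<sigma>)\<^sup>2))"
      using variance_le_dirichlet[OF assms(1-3), of f] R
      unfolding dirichlet_def[OF assms(1-3)] l_def R_def[symmetric] by (simp add: divide_le_eq mult.commute)
  qed (use l in \<open>auto simp: sum_pi_PCA pi_PCA_stationary\<close>)
  have event: "\<bar>sum (mat_pow (configs L) (P L J q) t \<sigma>) A - sum (pi_PCA L J q) A\<bar> \<le> b"
    if "\<sigma> \<in> configs L" "A \<subseteq> configs L" for \<sigma> A
  proof -
    define x where "x = sum (mat_pow (configs L) (P L J q) t \<sigma>) A - sum (pi_PCA L J q) A"
    have "exp (- (real (L\<^sup>2) * (2 * J + q + 1))) * x\<^sup>2 \<le> pi_PCA L J q \<sigma> * x\<^sup>2"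
      using assms that by (intro mult_right_mono pi_PCA_ge) auto
    also have "\<dots> \<le> (1 - l) ^ t"
      unfolding x_def using that by (rule event_deviation)
    also have "\<dots> \<le> exp (- l) ^ t"
      using l exp_ge_add_one_self[of "- l"] by (intro power_mono) auto
    finally have "x\<^sup>2 \<le> exp (- (l * t)) / exp (- (real (L\<^sup>2) * (2 * J + q + 1)))"
      by (simp add: pos_le_divide_eq mult.commute flip: exp_of_nat_mult)
    also have "\<dots> = b\<^sup>2"
      unfolding b_def exp_double[symmetric] by (simp add: l_def flip: exp_diff)
    finally have "\<bar>x\<bar>\<^sup>2 \<le> b\<^sup>2" by simp
    then show ?thesis
      unfolding x_def by (rule power2_le_imp_le) (simp add: b_def)
  qed
  have tv: "0 \<le> tv_dist (configs L) (mat_pow (configs L) (P L J q) t \<sigma>) (pi_PCA L J q)"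
    "tv_dist (configs L) (mat_pow (configs L) (P L J q) t \<sigma>) (pi_PCA L J q) \<le> b"
    if "\<sigma> \<in> configs L" for \<sigma>
  proof -
    have "bdd_above ((\<lambda>A. \<bar>sum (mat_pow (configs L) (P L J q) t \<sigma>) A - sum (pi_PCA L J q) A\<bar>) ` Pow (configs L))"
      using event[OF that] by (intro bdd_aboveI2) auto
    then show "0 \<le> tv_dist (configs L) (mat_pow (configs L) (P L J q) t \<sigma>) (pi_PCA L J q)"
      unfolding tv_dist_def by (rule cSUP_upper2[of _ _ "{}"]) auto
    show "tv_dist (configs L) (mat_pow (configs L) (P L J q) t \<sigma>) (pi_PCA L J q) \<le> b"
      unfolding tv_dist_def using event[OF that] by (intro cSUP_least) auto
  qed
  show "d_PCA L J q t \<le> b"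
    unfolding d_PCA_def using configs_nonempty tv(2) by (intro cSUP_least) auto
  obtain \<sigma> where "\<sigma> \<in> configs L" using configs_nonempty by blast
  moreover have "bdd_above ((\<lambda>\<sigma>. tv_dist (configs L) (mat_pow (configs L) (P L J q) t \<sigma>) (pi_PCA L J q)) ` configs L)"
    using tv(2) by (intro bdd_aboveI2) auto
  ultimately show "0 \<le> d_PCA L J q t"
    unfolding d_PCA_def using tv(1) by (intro cSUP_upper2[of _ _ \<sigma>]) auto
qed

section \<open>Asymptotics for the given parameters\<close>

theorem theorem2p4:
  fixes k c :: real
  assumes "c > 1 / 2" and "k - 4 * c > 4"
  shows "(\<lambda>L::nat. d_PCA L (k * ln (real L)) (c * (ln (real L) / real L))
            (nat \<lfloor>real L powr (8 * k)\<rfloor>)) \<longlonglongrightarrow> 0"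
proof -
  define J where "J L = k * ln (real L)" for L :: nat
  define q where "q L = c * (ln (real L) / real L)" for L :: nat
  define t where "t L = nat \<lfloor>real L powr (8 * k)\<rfloor>" for L :: nat
  \<comment> \<open>Bounds the factors of the relaxation time that depend on
    \<open>exp (2 * q L)\<close> alone, once \<open>q L < 1\<close>.\<close>
  define K where "K = exp 2 * (1 + exp 2 :: real)\<^sup>2"
  define l where "l L = 1 / (2 * real L ^ 4 * exp (8 * q L * L + 6 * J L + 2 * q L) * (1 + exp (2 * q L))\<^sup>2)"
    for L :: nat
  define b where "b L = exp ((real (L\<^sup>2) * (2 * (k * ln (real L)) + 2) - real L ^ 4 / (4 * K)) / 2)" for L :: nat
  have K: "0 < K" unfolding K_def by (intro mult_pos_pos zero_less_power add_pos_pos) auto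
  have "q \<longlonglongrightarrow> 0" unfolding q_def by real_asymp
  then have "\<forall>\<^sub>F L in sequentially. q L < 1" by (rule order_tendstoD) simp
  then have bounds: "\<forall>\<^sub>F L in sequentially.
      0 \<le> d_PCA L (J L) (q L) (t L) \<and> d_PCA L (J L) (q L) (t L) \<le> b L"
    using eventually_ge_at_top[of 2]
  proof eventually_elim
    case (elim L)
    have ln: "0 \<le> ln (real L)" using elim by simp
    have q: "0 \<le> q L" using ln assms(1) by (simp add: q_def)
    have qJ: "q L \<le> J L"
    proof -
      have "c * (ln (real L) / real L) \<le> c * (ln (real L) / 1)"
        using elim ln assms(1) by (intro mult_left_mono divide_left_mono) auto
      also have "\<dots> \<le> k * ln (real L)" using assms ln by (simp add: mult_right_mono)
      finally show ?thesis by (simp add: q_def J_def)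
    qed
    have "2 * real L ^ 4 * exp (8 * q L * L + 6 * J L + 2 * q L) * (1 + exp (2 * q L))\<^sup>2
      = 2 * (real L powr 4 * exp (8 * q L * L + 6 * J L)) * (exp (2 * q L) * (1 + exp (2 * q L))\<^sup>2)"
      using elim by (simp add: exp_add powr_numeral)
    also have "exp (8 * q L * L + 6 * J L) = real L powr (8 * c + 6 * k)"
      using elim by (simp add: q_def J_def powr_def algebra_simps)
    also have "real L powr 4 * real L powr (8 * c + 6 * k) = real L powr (4 + 8 * c + 6 * k)"
      by (simp add: powr_add)
    also have "2 * real L powr (4 + 8 * c + 6 * k) * (exp (2 * q L) * (1 + exp (2 * q L))\<^sup>2)
      \<le> 2 * real L powr (4 + 8 * c + 6 * k) * K"
      unfolding K_def using elim q by (intro mult_left_mono mult_mono power_mono add_mono) auto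
    finally have "1 / (2 * real L powr (4 + 8 * c + 6 * k) * K) \<le> l L"
      unfolding l_def using elim K
      by (intro divide_left_mono mult_pos_pos zero_less_power add_pos_pos) auto
    \<comment> \<open>The floor loses less than 1, which is at most half of a number that is at
      least 2.\<close>
    moreover have "real L powr (8 * k) / 2 \<le> t L"
    proof -
      have "real L powr 1 \<le> real L powr (8 * k)"
        using elim assms by (intro powr_mono) auto
      then have "2 \<le> real L powr (8 * k)" using elim by simp
      then show ?thesis unfolding t_def by linarith
    qed
    ultimately have "1 / (2 * real L powr (4 + 8 * c + 6 * k) * K) * (real L powr (8 * k) / 2) \<le> l L * t L"
      using K by (intro mult_mono) (auto simp: l_def)
    moreover have "1 / (2 * real L powr (4 + 8 * c + 6 * k) * K) * (real L powr (8 * k) / 2)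
      = real L powr (2 * k - 8 * c - 4) / (4 * K)"
    proof -
      have "real L powr (8 * k) = real L powr (2 * k - 8 * c - 4) * real L powr (4 + 8 * c + 6 * k)"
        by (simp flip: powr_add)
      then show ?thesis using elim by simp
    qed
    ultimately have "real L powr (2 * k - 8 * c - 4) / (4 * K) \<le> l L * t L" by simp
    \<comment> \<open>The hypothesis \<open>k - 4 * c > 4\<close> says that
      \<open>2 * k - 8 * c - 4\<close> exceeds 4, and the fourth power of \<open>L\<close> beats the
      warm-up term of order \<open>L\<^sup>2 * ln L\<close>.\<close>
    moreover have "real L powr 4 \<le> real L powr (2 * k - 8 * c - 4)"
      using elim assms by (intro powr_mono) auto
    then have "real L ^ 4 / (4 * K) \<le> real L powr (2 * k - 8 * c - 4) / (4 * K)"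
      using elim K by (intro divide_right_mono) (auto simp: powr_numeral)
    ultimately have lt: "real L ^ 4 / (4 * K) \<le> l L * t L" by linarith
    have "real (L\<^sup>2) * (2 * J L + q L + 1) - l L * t L \<le> real (L\<^sup>2) * (2 * J L + 2) - real L ^ 4 / (4 * K)"
      using elim lt by (intro diff_mono mult_left_mono) auto
    then have "exp ((real (L\<^sup>2) * (2 * J L + q L + 1) - l L * t L) / 2) \<le> b L"
      by (simp add: b_def J_def)
    then show ?case
      using d_PCA_bounds[OF elim(2) q qJ, of "t L"] unfolding l_def by linarith
  qed
  have "b \<longlonglongrightarrow> 0"
    unfolding b_def using K assms by real_asymp
  then have "(\<lambda>L. d_PCA L (J L) (q L) (t L)) \<longlonglongrightarrow> 0"
    by (rule tendsto_sandwich[OF _ _ tendsto_const, rotated -1]) (use bounds in \<open>auto elim: eventually_mono\<close>)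
  then show ?thesis by (simp add: J_def q_def t_def)
qed

end
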